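(* Let $n\ge m\ge 1$ and $1\le k\le n-1$ be integers. (i) Let $f$ be a continuous function on $\mathfrak M_{n,m}$ satisfying $f(x)=O(|I_m+x'x|^{-a/2})$. If $a>k+m-1$, then the Radon transform $\hat f(\tau)$ is finite for all matrix $k$-planes $\tau\in\mathfrak T$ (that is, $\hat f(\xi,t)$ is finite for all $(\xi,t)\in V_{n,n-k}\times\mathfrak M_{n-k,m}$). (ii) If $|I_m+x'x|^{\alpha/2}f(x)\in L^1(\mathfrak M_{n,m})$ for some $\alpha\ge k-n$, in particular if $f\in L^p(\mathfrak M_{n,m})$ with $1\le p<p_0$, $p_0=(n+m-1)/(k+m-1)$, then $\hat f(\tau)$ is finite for almost all $\tau\in\mathfrak T$ (that is, for almost all $(\xi,t)\in V_{n,n-k}\times\mathfrak M_{n-k,m}$).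
   Context: $\mathfrak M_{n,m}$ is the space of real $n\times m$ matrices with Lebesgue measure $dx=\prod_{i,j}dx_{i,j}$; $x'$ is the transpose of $x$; $I_m$ is the identity $m\times m$ matrix; $|a|$ is the absolute value of the determinant of a square matrix $a$. $V_{n,n-k}=\{\xi\in\mathfrak M_{n,n-k}:\xi'\xi=I_{n-k}\}$ is the Stiefel manifold with its $O(n)$-invariant measure. For $\xi\in V_{n,n-k}$, $t\in\mathfrak M_{n-k,m}$, the matrix $k$-plane is $\tau=\tau(\xi,t)=\{x\in\mathfrak M_{n,m}:\xi'x=t\}$; $\mathfrak T$ is the set of all matrix $k$-planes. The Radon transform of $f$ is $$\hat f(\tau)\equiv\hat f(\xi,t)=\int_{\mathfrak M_{k,m}} f\left(g_\xi\begin{bmatrix}\omega\\ t\end{bmatrix}\right)d\omega,$$ where $g_\xi\in SO(n)$ is any rotation with $g_\xi\xi_0=\xi$, $\xi_0=\begin{bmatrix}0\\ I_{n-k}\end{bmatrix}\in V_{n,n-k}$ (the value does not depend on the choice of $g_\xi$). "Finite" means that the integral converges absolutely. *)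

theory Defs
  imports "HOL-Analysis.Analysis" "HOL-Library.Landau_Symbols"
begin

text \<open>
  Real \<open>n \<times> m\<close> matrices are elements of \<^typ>\<open>real ^ 'm ^ 'n\<close>, whose Lebesgue measure is the product of
  the Lebesgue measures of the entries. The index type of the \<open>n\<close> rows is the sum
  \<open>'k + 'l\<close>, where \<open>'k\<close> indexes the first \<open>k\<close> rows and \<open>'l\<close> the last \<open>n - k\<close> rows. Since types are
  nonempty, \<open>m \<ge> 1\<close> and \<open>1 \<le> k \<le> n - 1\<close> hold automatically.
\<close>

definition stack :: "real ^ 'm ^ 'k \<Rightarrow> real ^ 'm ^ 'l \<Rightarrow> real ^ 'm ^ ('k::finite + 'l::finite)" where
  "stack \<omega> t = (\<chi> i. case i of Inl a \<Rightarrow> \<omega> $ a | Inr b \<Rightarrow> t $ b)"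

text \<open>The determinant of \<open>I\<^sub>m + x'x\<close> in absolute value.\<close>

definition gram_det :: "real ^ 'm ^ 'n \<Rightarrow> real" where
  "gram_det x = \<bar>det (mat 1 + transpose x ** x)\<bar>"

definition stiefel :: "(real ^ 'l ^ 'n) set" where
  "stiefel = {\<xi>. transpose \<xi> ** \<xi> = mat 1}"

text \<open>
  The \<open>O(n)\<close>-invariant measure on the Stiefel manifold is unique only up to a positive factor; the
  following predicate describes all its normalizations.
\<close>

definition stiefel_invariant_measure :: "(real ^ 'l ^ 'n) measure \<Rightarrow> bool" where
  "stiefel_invariant_measure \<sigma> \<longleftrightarrow>
     sets \<sigma> = sets (restrict_space borel stiefel) \<and>
     finite_measure \<sigma> \<and>
     emeasure \<sigma> (space \<sigma>) \<noteq> 0 \<and>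
     (\<forall>u. orthogonal_matrix u \<longrightarrow> distr \<sigma> \<sigma> (\<lambda>\<xi>. u ** \<xi>) = \<sigma>)"

definition stiefel_base :: "real ^ 'l ^ ('k::finite + 'l::finite)" where
  "stiefel_base = stack 0 (mat 1)"

text \<open>
  A rotation \<open>g\<^sub>\<xi>\<close> carrying the base frame to \<open>\<xi>\<close>. For \<open>\<xi>\<close> in the Stiefel manifold one exists because
  \<open>k \<ge> 1\<close>, and the Radon transform does not depend on which one is chosen.
\<close>

definition frame_rotation :: "real ^ 'l ^ ('k::finite + 'l::finite) \<Rightarrow> real ^ ('k + 'l) ^ ('k + 'l)" where
  "frame_rotation \<xi> = (SOME g. rotation_matrix g \<and> g ** stiefel_base = \<xi>)"

definition radon_integrand ::
  "(real ^ 'm ^ ('k::finite + 'l::finite) \<Rightarrow> complex) \<Rightarrow> real ^ 'l ^ ('k + 'l) \<Rightarrow> real ^ 'm ^ 'l \<Rightarrow> real ^ 'm ^ 'k \<Rightarrow> complex"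
  where "radon_integrand f \<xi> t \<omega> = f (frame_rotation \<xi> ** stack \<omega> t)"

definition radon_transform ::
  "(real ^ 'm ^ ('k::finite + 'l::finite) \<Rightarrow> complex) \<Rightarrow> real ^ 'l ^ ('k + 'l) \<Rightarrow> real ^ 'm ^ 'l \<Rightarrow> complex" where
  "radon_transform f \<xi> t = integral\<^sup>L lebesgue (radon_integrand f \<xi> t)"

text \<open>
  Absolute convergence of the integral defining \<^const>\<open>radon_transform\<close>. (The value of a Bochner
  integral cannot express this, since it is \<open>0\<close> for non-integrable functions.)
\<close>

definition radon_finite ::
  "(real ^ 'm ^ ('k::finite + 'l::finite) \<Rightarrow> complex) \<Rightarrow> real ^ 'l ^ ('k + 'l) \<Rightarrow> real ^ 'm ^ 'l \<Rightarrow> bool" where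
  "radon_finite f \<xi> t \<longleftrightarrow> integrable lebesgue (radon_integrand f \<xi> t)"

definition in_Lp :: "real \<Rightarrow> (real ^ 'm ^ 'n \<Rightarrow> complex) \<Rightarrow> bool" where
  "in_Lp p f \<longleftrightarrow> f \<in> borel_measurable lebesgue \<and> integrable lebesgue (\<lambda>x. norm (f x) powr p)"

text \<open>\<open>|I\<^sub>m + x'x|\<^bsup>\<alpha>/2\<^esup> f(x)\<close> belongs to \<open>L\<^sup>1\<close>.\<close>

definition in_weighted_L1 :: "real \<Rightarrow> (real ^ 'm ^ 'n \<Rightarrow> complex) \<Rightarrow> bool" where
  "in_weighted_L1 \<alpha> f \<longleftrightarrow> integrable lebesgue (\<lambda>x. complex_of_real (gram_det x powr (\<alpha> / 2)) * f x)"

end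

theory Submission
  imports Defs
begin

text \<open>
  Everything rests on two estimates. The first is the convergence of
  \<open>\<integral> |I\<^sub>m + x'x|\<^bsup>-a/2\<^esup> dx\<close> over \<open>r \<times> m\<close> matrices for \<open>a > r + m - 1\<close>: if \<open>A\<close> collects the other
  rows, the integral over one row \<open>y\<close> of \<open>|A + yy'|\<^bsup>-a/2\<^esup>\<close> is a constant times
  \<open>|A|\<^bsup>-(a-1)/2\<^esup>\<close>, finite if \<open>a > m\<close>, so each row lowers \<open>a\<close> by one. It gives part (i), and through
  Young's inequality the inclusion of \<open>L\<^sup>p\<close> in the weighted \<open>L\<^sup>1\<close> space.

  The second is \<open>\<Phi>(x) = \<integral> exp (-|\<xi>'x|\<^sup>2) d\<sigma>(\<xi>) \<le> C |I\<^sub>m + x'x|\<^bsup>(k-n)/2\<^esup>\<close>. Since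
  \<open>\<integral> \<integral> \<^bold>R(\<xi>, t) exp (-|t|\<^sup>2) dt d\<sigma>(\<xi>) = \<integral> |f| \<Phi>\<close> for the Radon transform \<open>\<^bold>R\<close> of \<open>|f|\<close>, it gives
  part (ii). Write \<open>I\<^sub>n + xx' = BB'\<close>, so that \<open>\<Phi>(x)\<close> is \<open>\<Phi>(B)\<close> up to a constant. Averaging \<open>\<Phi>(WB)\<close>
  over a Gaussian \<open>n \<times> n\<close> matrix \<open>W\<close> yields, by the rotation invariance of the Gaussian, an explicit integral bounded by a
  multiple of \<open>|B|\<^bsup>k-n\<^esup>\<close>, and \<open>\<Phi>(WB) \<ge> \<Phi>(B)\<close> for every contraction \<open>W\<close>. Neither the uniqueness of \<open>\<sigma>\<close> nor a polar
  decomposition of Lebesgue measure is needed.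
\<close>

subsection \<open>Lebesgue measure on spaces of matrices\<close>

lemma mem_box_vec: "x \<in> box l u \<longleftrightarrow> (\<forall>i. x $ i \<in> box (l $ i) (u $ i))"
  for x :: "'a::euclidean_space ^ 'n"
  by (auto simp: mem_box Basis_vec_def inner_axis)

lemma prod_Basis_vec:
  "(\<Prod>b\<in>(Basis :: ('a::euclidean_space ^ 'n) set). f b) = (\<Prod>i\<in>UNIV. \<Prod>u\<in>Basis. f (axis i u))"
proof -
  have "bij_betw (\<lambda>(i, u). axis i u) (UNIV \<times> Basis) (Basis :: ('a ^ 'n) set)"
    by (force simp: bij_betw_def inj_on_def axis_eq_axis Basis_vec_def)
  then have "(\<Prod>b\<in>(Basis :: ('a ^ 'n) set). f b) = (\<Prod>(i, u)\<in>UNIV \<times> Basis. f (axis i u))"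
    by (subst prod.reindex_bij_betw[symmetric]) (auto intro!: prod.cong)
  then show ?thesis
    by (simp add: prod.cartesian_product)
qed

text \<open>The basis vectors are the \<open>axis i u\<close>, so the volume of a box factors over
  the components. This is the test by which all measures on vectors and matrices below are
  identified.\<close>

lemma lborel_vec_eqI:
  fixes M :: "('a::euclidean_space ^ 'n) measure"
  assumes "sets M = sets borel"
    and "\<And>l u. emeasure M (box l u) = (\<Prod>i\<in>UNIV. emeasure lborel (box (l $ i) (u $ i)))"
  shows "lborel = M"
proof (rule lborel_eqI)
  fix l u :: "'a ^ 'n"
  assume le: "\<And>b. b \<in> Basis \<Longrightarrow> l \<bullet> b \<le> u \<bullet> b"
  have le': "l $ i \<bullet> b \<le> u $ i \<bullet> b" if "b \<in> Basis" for i b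
    using le[of "axis i b"] that by (simp add: inner_axis)
  then have nonneg: "0 \<le> (u $ i - l $ i) \<bullet> b" if "b \<in> Basis" for i b
    using that by (simp add: inner_diff_left)
  have "emeasure M (box l u) = (\<Prod>i\<in>UNIV. ennreal (\<Prod>b\<in>Basis. (u $ i - l $ i) \<bullet> b))"
    using le' by (simp add: assms(2) emeasure_lborel_box_eq)
  also have "\<dots> = ennreal (\<Prod>i\<in>UNIV. \<Prod>b\<in>Basis. (u $ i - l $ i) \<bullet> b)"
    using nonneg by (intro prod_ennreal prod_nonneg) auto
  also have "\<dots> = ennreal (\<Prod>b\<in>Basis. (u - l) \<bullet> b)"
    by (simp add: prod_Basis_vec inner_axis)
  finally show "emeasure M (box l u) = (\<Prod>b\<in>Basis. (u - l) \<bullet> b)" .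
qed (fact assms(1))

lemma borel_measurable_vec:
  fixes f :: "'b \<Rightarrow> 'a::euclidean_space ^ 'n"
  assumes "\<And>i. (\<lambda>x. f x $ i) \<in> borel_measurable M"
  shows "f \<in> borel_measurable M"
  unfolding borel_measurable_euclidean_space[where f = f]
proof
  fix b :: "'a ^ 'n" assume "b \<in> Basis"
  then obtain i u where "b = axis i u"
    by (auto simp: Basis_vec_def)
  then show "(\<lambda>x. f x \<bullet> b) \<in> borel_measurable M"
    using assms[of i] by (simp add: inner_axis)
qed

lemma borel_measurable_vec_nth[measurable]:
  "(\<lambda>x :: 'a::euclidean_space ^ 'n. x $ i) \<in> borel \<rightarrow>\<^sub>M borel"
  by (intro borel_measurable_continuous_onI continuous_intros)

lemma borel_measurable_vec_lambda[measurable (raw)]: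
  fixes f :: "'n::finite \<Rightarrow> 'b \<Rightarrow> 'a::euclidean_space"
  assumes "\<And>i. f i \<in> borel_measurable M"
  shows "(\<lambda>x. \<chi> i. f i x) \<in> borel_measurable M"
  by (rule borel_measurable_vec) (use assms in simp)

text \<open>Both measures are multiplicative on boxes. The product form allows integrating one
  component at a time.\<close>

lemma lborel_vec_eq_PiM:
  "(lborel :: ('a::euclidean_space ^ 'n) measure) = distr (\<Pi>\<^sub>M i\<in>UNIV. lborel) borel vec_lambda"
proof (rule lborel_vec_eqI)
  interpret product_sigma_finite "\<lambda>_ :: 'n. lborel :: 'a measure" ..
  have [measurable]: "(vec_lambda :: _ \<Rightarrow> 'a ^ 'n) \<in> (\<Pi>\<^sub>M i\<in>UNIV. lborel) \<rightarrow>\<^sub>M borel"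
    by (rule borel_measurable_vec) simp
  fix l u :: "'a ^ 'n"
  have *: "vec_lambda -` box l u \<inter> space (\<Pi>\<^sub>M i\<in>UNIV. lborel) = (\<Pi>\<^sub>E i\<in>UNIV. box (l $ i) (u $ i))"
    by (auto simp: mem_box_vec space_PiM PiE_iff)
  show "emeasure (distr (\<Pi>\<^sub>M i\<in>UNIV. lborel) borel vec_lambda) (box l u)
      = (\<Prod>i\<in>UNIV. emeasure lborel (box (l $ i) (u $ i)))"
    by (subst emeasure_distr) (simp_all add: * emeasure_PiM)
qed simp

lemma emeasure_lborel_box_vec:
  fixes l u :: "'a::euclidean_space ^ 'n"
  shows "emeasure lborel (box l u) = (\<Prod>i\<in>UNIV. emeasure lborel (box (l $ i) (u $ i)))"
proof -
  interpret product_sigma_finite "\<lambda>_ :: 'n. lborel :: 'a measure" ..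
  have [measurable]: "(vec_lambda :: _ \<Rightarrow> 'a ^ 'n) \<in> (\<Pi>\<^sub>M i\<in>UNIV. lborel) \<rightarrow>\<^sub>M borel"
    by (rule borel_measurable_vec) simp
  have *: "vec_lambda -` box l u \<inter> space (\<Pi>\<^sub>M i\<in>UNIV. lborel) = (\<Pi>\<^sub>E i\<in>UNIV. box (l $ i) (u $ i))"
    by (auto simp: mem_box_vec space_PiM PiE_iff)
  show ?thesis
    by (subst lborel_vec_eq_PiM, subst emeasure_distr) (simp_all add: * emeasure_PiM)
qed

lemma nn_integral_lborel_vec:
  fixes f :: "'a::euclidean_space ^ 'n \<Rightarrow> ennreal"
  assumes [measurable]: "f \<in> borel_measurable borel"
  shows "(\<integral>\<^sup>+x. f x \<partial>lborel) = (\<integral>\<^sup>+g. f (vec_lambda g) \<partial>(\<Pi>\<^sub>M i\<in>UNIV. lborel))"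
proof -
  have [measurable]: "(vec_lambda :: _ \<Rightarrow> 'a ^ 'n) \<in> (\<Pi>\<^sub>M i\<in>UNIV. lborel) \<rightarrow>\<^sub>M borel"
    by (rule borel_measurable_vec) simp
  show ?thesis
    by (subst lborel_vec_eq_PiM) (simp add: nn_integral_distr)
qed

lemma nn_integral_lborel_vec_prod:
  fixes f :: "'n::finite \<Rightarrow> 'a::euclidean_space \<Rightarrow> ennreal"
  assumes [measurable]: "\<And>i. f i \<in> borel_measurable borel"
  shows "(\<integral>\<^sup>+x. (\<Prod>i\<in>UNIV. f i (x $ i)) \<partial>lborel) = (\<Prod>i\<in>UNIV. \<integral>\<^sup>+y. f i y \<partial>lborel)"
proof -
  interpret product_sigma_finite "\<lambda>_ :: 'n. lborel :: 'a measure" ..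
  show ?thesis
    by (subst nn_integral_lborel_vec) (simp_all add: product_nn_integral_prod)
qed

section \<open>Measurability of matrix operations\<close>

lemma borel_measurable_matrix_mult[measurable (raw)]:
  fixes f :: "'b \<Rightarrow> real ^ 'n ^ 'm" and g :: "'b \<Rightarrow> real ^ 'k ^ 'n"
  assumes [measurable]: "f \<in> borel_measurable M" "g \<in> borel_measurable M"
  shows "(\<lambda>x. f x ** g x) \<in> borel_measurable M"
  unfolding matrix_matrix_mult_def by measurable

lemma borel_measurable_matrix_vector_mult[measurable (raw)]:
  fixes f :: "'b \<Rightarrow> real ^ 'n ^ 'm" and g :: "'b \<Rightarrow> real ^ 'n"
  assumes [measurable]: "f \<in> borel_measurable M" "g \<in> borel_measurable M"
  shows "(\<lambda>x. f x *v g x) \<in> borel_measurable M"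
  unfolding matrix_vector_mult_def by measurable

lemma borel_measurable_transpose[measurable (raw)]:
  fixes f :: "'b \<Rightarrow> real ^ 'n ^ 'm"
  assumes [measurable]: "f \<in> borel_measurable M"
  shows "(\<lambda>x. transpose (f x)) \<in> borel_measurable M"
  unfolding transpose_def by measurable

lemma borel_measurable_det[measurable (raw)]:
  fixes f :: "'b \<Rightarrow> real ^ 'n ^ 'n"
  assumes [measurable]: "f \<in> borel_measurable M"
  shows "(\<lambda>x. det (f x)) \<in> borel_measurable M"
  unfolding det_def by measurable

lemma borel_measurable_stack[measurable (raw)]:
  fixes f :: "'b \<Rightarrow> real ^ 'm ^ 'k::finite" and g :: "'b \<Rightarrow> real ^ 'm ^ 'l::finite"
  assumes [measurable]: "f \<in> borel_measurable M" "g \<in> borel_measurable M"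
  shows "(\<lambda>x. stack (f x) (g x)) \<in> borel_measurable M"
proof -
  have "(\<lambda>x. case i of Inl a \<Rightarrow> f x $ a | Inr b \<Rightarrow> g x $ b) \<in> borel_measurable M" for i
    by (cases i) simp_all
  then show ?thesis
    unfolding stack_def by (rule borel_measurable_vec_lambda)
qed

text \<open>The volume of a box is a double product over the entries, and transposition only
  exchanges the order of the two products.\<close>

lemma distr_transpose_lborel:
  "distr lborel borel transpose = (lborel :: (real ^ 'n ^ 'm) measure)"
proof (rule lborel_vec_eqI[symmetric])
  fix l u :: "real ^ 'n ^ 'm"
  have "transpose -` box l u = box (transpose l) (transpose u)"
    by (auto simp: mem_box_vec transpose_def)
  then have "emeasure (distr lborel borel transpose) (box l u)
      = emeasure lborel (box (transpose l) (transpose u))"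
    by (subst emeasure_distr) auto
  also have "\<dots> = (\<Prod>j\<in>UNIV. \<Prod>i\<in>UNIV. emeasure lborel (box (l $ i $ j) (u $ i $ j)))"
    by (simp add: emeasure_lborel_box_vec transpose_def)
  also have "\<dots> = (\<Prod>i\<in>UNIV. \<Prod>j\<in>UNIV. emeasure lborel (box (l $ i $ j) (u $ i $ j)))"
    by (rule prod.swap)
  finally show "emeasure (distr lborel borel transpose) (box l u)
      = (\<Prod>i\<in>UNIV. emeasure lborel (box (l $ i) (u $ i)))"
    by (simp add: emeasure_lborel_box_vec)
qed simp

lemma emeasure_lborel_vec_Collect:
  fixes B :: "'n::finite \<Rightarrow> 'a::euclidean_space set"
  assumes [measurable]: "\<And>i. B i \<in> sets borel"
  shows "emeasure lborel {x :: 'a ^ 'n. \<forall>i. x $ i \<in> B i} = (\<Prod>i\<in>UNIV. emeasure lborel (B i))"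
proof -
  have "emeasure lborel {x :: 'a ^ 'n. \<forall>i. x $ i \<in> B i}
      = (\<integral>\<^sup>+x. indicator {x :: 'a ^ 'n. \<forall>i. x $ i \<in> B i} x \<partial>lborel)"
    by (rule nn_integral_indicator[symmetric]) simp
  also have "\<dots> = (\<integral>\<^sup>+x. (\<Prod>i\<in>UNIV. indicator (B i) (x $ i)) \<partial>(lborel :: ('a ^ 'n) measure))"
    by (intro nn_integral_cong) (auto simp: indicator_def)
  also have "\<dots> = (\<Prod>i\<in>UNIV. \<integral>\<^sup>+y. indicator (B i) y \<partial>lborel)"
    by (rule nn_integral_lborel_vec_prod) measurable
  finally show ?thesis
    by simp
qed

section \<open>Linear changes of variables\<close>

lemma det_shear_matrix:
  assumes "m \<noteq> n"
  shows "det (\<chi> i j. if i = m \<and> j = n then c else of_bool (i = j) :: real ^ 'n ^ 'n) = 1"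
proof -
  have "(\<chi> i j. if i = m \<and> j = n then c else of_bool (i = j) :: real ^ 'n ^ 'n)
      = (\<chi> k. if k = m then row m (mat 1) + c *s row n (mat 1) else row k (mat 1))"
    using assms by (auto simp: vec_eq_iff row_def mat_def)
  then show ?thesis
    using det_row_operation[OF assms, of "mat 1" c] by simp
qed

lemma det_swap_matrix:
  assumes "m \<noteq> n"
  shows "det (\<chi> i j. mat 1 $ i $ Transposition.transpose m n j :: real ^ 'n ^ 'n) = -1"
  using assms by (subst det_permute_columns[OF permutes_swap_id]) (auto simp: sign_swap_id)

text \<open>With the other coordinates fixed, the shear translates coordinate \<open>m\<close> by a
  constant, and Lebesgue measure on the line is translation invariant. Tonelli with coordinate
  \<open>m\<close> innermost gives the result.\<close>

lemma nn_integral_lborel_shear: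
  fixes f :: "real ^ 'n \<Rightarrow> ennreal"
  assumes "m \<noteq> n" and [measurable]: "f \<in> borel_measurable borel"
  shows "(\<integral>\<^sup>+x. f (\<chi> i. if i = m then x $ m + c * x $ n else x $ i) \<partial>lborel) = (\<integral>\<^sup>+x. f x \<partial>lborel)"
proof -
  interpret product_sigma_finite "\<lambda>_ :: 'n. lborel :: real measure" ..
  have U: "UNIV = insert m (UNIV - {m})"
    by auto
  have split: "(\<integral>\<^sup>+x. g x \<partial>lborel)
      = (\<integral>\<^sup>+x. \<integral>\<^sup>+y. g (vec_lambda (x(m := y))) \<partial>lborel \<partial>(\<Pi>\<^sub>M i\<in>UNIV - {m}. lborel))"
    if [measurable]: "g \<in> borel_measurable borel" for g :: "real ^ 'n \<Rightarrow> ennreal"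
  proof -
    have [measurable]: "(vec_lambda :: _ \<Rightarrow> real ^ 'n) \<in> (\<Pi>\<^sub>M i\<in>insert m (UNIV - {m}). lborel) \<rightarrow>\<^sub>M borel"
      by (rule borel_measurable_vec) simp
    show ?thesis
      unfolding nn_integral_lborel_vec[OF that]
      by (subst U, rule product_nn_integral_insert) simp_all
  qed
  have "(\<integral>\<^sup>+y. f (\<chi> i. if i = m then y + c * x n else x i) \<partial>lborel)
      = (\<integral>\<^sup>+y. f (vec_lambda (x(m := y))) \<partial>lborel)" for x :: "'n \<Rightarrow> real"
  proof -
    have [measurable]: "(\<lambda>y. f (vec_lambda (x(m := y)))) \<in> borel_measurable borel"
      by (intro measurable_compose[OF _ assms(2)] borel_measurable_vec) (simp add: fun_upd_def)
    have eq: "(\<chi> i. if i = m then y + c * x n else x i) = vec_lambda (x(m := c * x n + 1 * y))" for y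
      by (simp add: vec_eq_iff)
    show ?thesis
      unfolding eq using nn_integral_real_affine[of "\<lambda>y. f (vec_lambda (x(m := y)))" 1 "c * x n"]
      by simp
  qed
  then have "(\<integral>\<^sup>+y. f (\<chi> i. if i = m then vec_lambda (x(m := y)) $ m + c * vec_lambda (x(m := y)) $ n
        else vec_lambda (x(m := y)) $ i) \<partial>lborel)
      = (\<integral>\<^sup>+y. f (vec_lambda (x(m := y))) \<partial>lborel)" for x :: "'n \<Rightarrow> real"
    using \<open>m \<noteq> n\<close> by (simp cong: if_cong)
  moreover have "(\<lambda>x. f (\<chi> i. if i = m then x $ m + c * x $ n else x $ i)) \<in> borel_measurable borel"
    by (intro measurable_compose[OF _ assms(2)] borel_measurable_vec) simp
  ultimately show ?thesis
    by (simp add: split)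
qed

text \<open>The formula is multiplicative in \<open>S\<close>, so elementary matrices suffice.
  Diagonal matrices and swaps are checked on boxes, shears were treated above, and a zero row
  contradicts the invertibility of \<open>S\<close>.\<close>

lemma nn_integral_lborel_matrix_vector_mult:
  fixes S :: "real ^ 'n ^ 'n" and f :: "real ^ 'n \<Rightarrow> ennreal"
  assumes "det S \<noteq> 0" "f \<in> borel_measurable borel"
  shows "(\<integral>\<^sup>+x. f x \<partial>lborel) = ennreal \<bar>det S\<bar> * (\<integral>\<^sup>+x. f (S *v x) \<partial>lborel)"
  using assms
proof (induction S arbitrary: f rule: induct_matrix_elementary)
  case mult: (1 A B)
  note [measurable] = \<open>f \<in> borel_measurable borel\<close>
  have dets: "det A \<noteq> 0" "det B \<noteq> 0"
    using mult(3) by (simp_all add: det_mul)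
  have "(\<integral>\<^sup>+x. f x \<partial>lborel) = ennreal \<bar>det A\<bar> * (\<integral>\<^sup>+x. f (A *v x) \<partial>lborel)"
    by (rule mult(1)) (use dets in simp_all)
  \<comment> \<open>The hypothesis for \<open>B\<close> is applied to the integrand already composed
    with \<open>A\<close>; hence the induction over arbitrary \<open>f\<close>.\<close>
  also have "\<dots> = ennreal \<bar>det A\<bar> * (ennreal \<bar>det B\<bar> * (\<integral>\<^sup>+x. f (A *v (B *v x)) \<partial>lborel))"
    by (subst mult(2)[of "\<lambda>x. f (A *v x)"]) (use dets in simp_all)
  finally show ?case
    by (simp add: det_mul abs_mult ennreal_mult matrix_vector_mul_assoc mult.assoc)
next
  case zero_row: (2 A i)
  then show ?case
    by (simp add: det_zero_row)
next
  case diagonal: (3 A)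
  note [measurable] = \<open>f \<in> borel_measurable borel\<close>
  have det: "det A = (\<Prod>i\<in>UNIV. A $ i $ i)"
    using diagonal by (intro det_diagonal) auto
  have nz: "A $ i $ i \<noteq> 0" for i
    using \<open>det A \<noteq> 0\<close> by (simp add: det)
  have Av: "A *v x = (\<chi> i. A $ i $ i * x $ i)" for x
  proof -
    have "(\<Sum>j\<in>UNIV. A $ i $ j * x $ j) = (\<Sum>j\<in>{i}. A $ i $ j * x $ j)" for i
      by (rule sum.mono_neutral_right) (use diagonal(1) in auto)
    then show ?thesis
      by (simp add: matrix_vector_mult_def)
  qed
  have "lborel = scale_measure (ennreal \<bar>det A\<bar>) (distr lborel borel ((*v) A))"
  proof (rule lborel_vec_eqI)
    fix l u :: "real ^ 'n"
    have "emeasure (distr lborel borel ((*v) A)) (box l u)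
        = emeasure lborel {x. \<forall>i. x $ i \<in> (*) (A $ i $ i) -` box (l $ i) (u $ i)}"
      by (subst emeasure_distr) (auto simp: Av mem_box_vec intro!: arg_cong[where f = "emeasure lborel"])
    also have "\<dots> = (\<Prod>i\<in>UNIV. emeasure lborel ((*) (A $ i $ i) -` box (l $ i) (u $ i)))"
      using measurable_sets[of "(*) (A $ i $ i)" borel borel "box (l $ i) (u $ i)" for i]
      by (intro emeasure_lborel_vec_Collect) simp
    finally have "emeasure (scale_measure (ennreal \<bar>det A\<bar>) (distr lborel borel ((*v) A))) (box l u)
        = (\<Prod>i\<in>UNIV. \<bar>A $ i $ i\<bar> * emeasure lborel ((*) (A $ i $ i) -` box (l $ i) (u $ i)))"
      by (simp add: det abs_prod prod.distrib prod_ennreal)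
    also have "\<dots> = (\<Prod>i\<in>UNIV. emeasure lborel (box (l $ i) (u $ i)))"
    proof (rule prod.cong[OF refl])
      fix i
      show "\<bar>A $ i $ i\<bar> * emeasure lborel ((*) (A $ i $ i) -` box (l $ i) (u $ i))
          = emeasure lborel (box (l $ i) (u $ i))"
        by (subst (2) lborel_real_affine[OF nz, of 0 i])
          (simp add: emeasure_density_const emeasure_distr)
    qed
    finally show "emeasure (scale_measure (ennreal \<bar>det A\<bar>) (distr lborel borel ((*v) A))) (box l u)
        = (\<Prod>i\<in>UNIV. emeasure lborel (box (l $ i) (u $ i)))" .
  qed simp
  then have "nn_integral lborel f = nn_integral (scale_measure (ennreal \<bar>det A\<bar>) (distr lborel borel ((*v) A))) f"
    by (rule arg_cong)
  also have "\<dots> = ennreal \<bar>det A\<bar> * (\<integral>\<^sup>+x. f (A *v x) \<partial>lborel)"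
    by (simp add: nn_integral_scale_measure nn_integral_distr)
  finally show ?case .
next
  case swap1: (4 m n)
  note [measurable] = \<open>f \<in> borel_measurable borel\<close>
  define A :: "real ^ 'n ^ 'n" where "A = (\<chi> i j. mat 1 $ i $ Transposition.transpose m n j)"
  let ?p = "Transposition.transpose m n"
  have p: "?p permutes UNIV"
    by (rule permutes_swap_id) auto
  have Av: "A *v x = (\<chi> i. x $ ?p i)" for x
  proof -
    have "(\<Sum>j\<in>UNIV. (if i = ?p j then 1 else 0) * x $ j) = (\<Sum>j\<in>{?p i}. x $ j)" for i
      by (rule sum.mono_neutral_cong_right) auto
    then show ?thesis
      by (simp add: matrix_vector_mult_def A_def mat_def)
  qed
  have "\<bar>det A\<bar> = 1"
    unfolding A_def using \<open>m \<noteq> n\<close> by (simp add: det_swap_matrix)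
  have "lborel = distr lborel borel ((*v) A)"
  proof (rule lborel_vec_eqI)
    fix l u :: "real ^ 'n"
    have all: "(\<forall>i. P i) \<longleftrightarrow> (\<forall>i. P (?p i))" for P
      by (metis transpose_involutory)
    have "x \<in> (*v) A -` box l u \<longleftrightarrow> x \<in> box (\<chi> i. l $ ?p i) (\<chi> i. u $ ?p i)" for x
      using all[of "\<lambda>i. x $ ?p i \<in> box (l $ i) (u $ i)"] by (simp add: Av mem_box_vec)
    then have pre: "(*v) A -` box l u = box (\<chi> i. l $ ?p i) (\<chi> i. u $ ?p i)"
      by blast
    have "emeasure (distr lborel borel ((*v) A)) (box l u)
        = emeasure lborel (box (\<chi> i. l $ ?p i) (\<chi> i. u $ ?p i))"
      by (subst emeasure_distr) (simp_all add: pre)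
    also have "\<dots> = (\<Prod>i\<in>UNIV. emeasure lborel (box (l $ i) (u $ i)))"
      by (simp only: emeasure_lborel_box_vec vec_lambda_beta)
         (rule prod.permute[OF p, symmetric, unfolded comp_def])
    finally show "emeasure (distr lborel borel ((*v) A)) (box l u)
        = (\<Prod>i\<in>UNIV. emeasure lborel (box (l $ i) (u $ i)))" .
  qed simp
  then have "nn_integral lborel f = nn_integral (distr lborel borel ((*v) A)) f"
    by (rule arg_cong)
  then show ?case
    by (simp add: nn_integral_distr \<open>\<bar>det A\<bar> = 1\<close> flip: A_def)
next
  case idplus: (5 m n c)
  define A :: "real ^ 'n ^ 'n" where "A = (\<chi> i j. if i = m \<and> j = n then c else of_bool (i = j))"
  have Av: "A *v x = (\<chi> i. if i = m then x $ m + c * x $ n else x $ i)" for x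
  proof -
    have "(\<Sum>j\<in>UNIV. (if i = m \<and> j = n then c else of_bool (i = j)) * x $ j)
        = (\<Sum>j\<in>UNIV. (if j = i then x $ j else 0) + (if j = n then if i = m then c * x $ j else 0 else 0))" for i
      using \<open>m \<noteq> n\<close> by (intro sum.cong) auto
    then show ?thesis
      by (simp add: matrix_vector_mult_def A_def vec_eq_iff sum.distrib)
  qed
  have "det A = 1"
    unfolding A_def using \<open>m \<noteq> n\<close> by (rule det_shear_matrix)
  then show ?case
    using idplus by (simp add: A_def[symmetric] Av nn_integral_lborel_shear)
qed

text \<open>Recasts the change of variables as an identity of measures, the form that passes to
  products.\<close>

lemma lborel_eq_scale_matrix_vector:
  fixes S :: "real ^ 'n ^ 'n"
  assumes "det S \<noteq> 0"
  shows "lborel = scale_measure (ennreal \<bar>det S\<bar>) (distr lborel borel ((*v) S))"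
proof (rule measure_eqI)
  fix X :: "(real ^ 'n) set" assume X: "X \<in> sets lborel"
  have "emeasure lborel X = (\<integral>\<^sup>+x. indicator X x \<partial>lborel)"
    using X by simp
  also have "\<dots> = ennreal \<bar>det S\<bar> * (\<integral>\<^sup>+x. indicator X (S *v x) \<partial>lborel)"
    using X assms by (intro nn_integral_lborel_matrix_vector_mult) simp_all
  also have "(\<integral>\<^sup>+x. indicator X (S *v x) \<partial>lborel) = (\<integral>\<^sup>+x. indicator X x \<partial>distr lborel borel ((*v) S))"
    using X by (subst nn_integral_distr) simp_all
  finally show "emeasure lborel X
      = emeasure (scale_measure (ennreal \<bar>det S\<bar>) (distr lborel borel ((*v) S))) X"
    using X by simp
qed simp

text \<open>If \<open>T\<close> scales volume by a factor, applying it to each of the components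
  scales the product volume by the corresponding power, as boxes show.\<close>

lemma lborel_vec_eq_scale:
  fixes T :: "'a::euclidean_space \<Rightarrow> 'a"
  assumes [measurable]: "T \<in> borel \<rightarrow>\<^sub>M borel"
    and T: "lborel = scale_measure c (distr lborel borel T)"
  shows "(lborel :: ('a ^ 'n) measure)
    = scale_measure (c ^ CARD('n)) (distr lborel borel (\<lambda>x. \<chi> i. T (x $ i)))"
proof (rule lborel_vec_eqI)
  fix l u :: "'a ^ 'n"
  have [measurable]: "T -` box (l $ i) (u $ i) \<in> sets borel" for i
    using measurable_sets[OF assms(1), of "box (l $ i) (u $ i)"] by simp
  have "(\<lambda>x. \<chi> i. T (x $ i)) -` box l u = {x. \<forall>i. x $ i \<in> T -` box (l $ i) (u $ i)}"
    by (auto simp: mem_box_vec)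
  then have "emeasure (distr lborel borel (\<lambda>x. \<chi> i. T (x $ i))) (box l u)
      = (\<Prod>i\<in>UNIV. emeasure lborel (T -` box (l $ i) (u $ i)))"
    using emeasure_lborel_vec_Collect[of "\<lambda>i. T -` box (l $ i) (u $ i)"]
    by (subst emeasure_distr) simp_all
  then have "emeasure (scale_measure (c ^ CARD('n)) (distr lborel borel (\<lambda>x. \<chi> i. T (x $ i)))) (box l u)
      = (\<Prod>i\<in>UNIV. c * emeasure lborel (T -` box (l $ i) (u $ i)))"
    by (simp add: prod.distrib)
  also have "\<dots> = (\<Prod>i\<in>UNIV. emeasure lborel (box (l $ i) (u $ i)))"
    by (rule prod.cong[OF refl], subst (2) T) (simp add: emeasure_distr)
  finally show "emeasure (scale_measure (c ^ CARD('n)) (distr lborel borel (\<lambda>x. \<chi> i. T (x $ i)))) (box l u)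
      = (\<Prod>i\<in>UNIV. emeasure lborel (box (l $ i) (u $ i)))" .
qed simp

lemma nn_integral_lborel_transpose:
  fixes f :: "real ^ 'n ^ 'm \<Rightarrow> ennreal"
  assumes [measurable]: "f \<in> borel_measurable borel"
  shows "(\<integral>\<^sup>+x. f (transpose x) \<partial>lborel) = (\<integral>\<^sup>+x. f x \<partial>lborel)"
  by (subst (2) distr_transpose_lborel[symmetric]) (simp add: nn_integral_distr)

text \<open>Left multiplication by \<open>S\<close> acts on each column separately. Transposing
  turns the columns into components, each contributing one factor
  \<open>\<bar>det S\<bar>\<close>.\<close>

lemma nn_integral_lborel_matrix_mult:
  fixes S :: "real ^ 'n ^ 'n" and f :: "real ^ 'm ^ 'n \<Rightarrow> ennreal"
  assumes "det S \<noteq> 0" and [measurable]: "f \<in> borel_measurable borel"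
  shows "(\<integral>\<^sup>+x. f x \<partial>lborel) = ennreal (\<bar>det S\<bar> ^ CARD('m)) * (\<integral>\<^sup>+x. f (S ** x) \<partial>lborel)"
proof -
  have eq: "transpose (\<chi> j. S *v (x $ j)) = S ** transpose x" for x :: "real ^ 'n ^ 'm"
    by (simp add: vec_eq_iff transpose_def matrix_vector_mult_def matrix_matrix_mult_def)
  have "(\<integral>\<^sup>+x. f x \<partial>lborel) = (\<integral>\<^sup>+x. f (transpose x) \<partial>(lborel :: (real ^ 'n ^ 'm) measure))"
    by (simp add: nn_integral_lborel_transpose)
  also have "\<dots> = ennreal \<bar>det S\<bar> ^ CARD('m) *
      (\<integral>\<^sup>+x. f (S ** transpose x) \<partial>(lborel :: (real ^ 'n ^ 'm) measure))"
    by (subst lborel_vec_eq_scale[OF _ lborel_eq_scale_matrix_vector[OF assms(1)]])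
       (simp_all add: nn_integral_scale_measure nn_integral_distr eq)
  also have "(\<integral>\<^sup>+x. f (S ** transpose x) \<partial>(lborel :: (real ^ 'n ^ 'm) measure))
      = (\<integral>\<^sup>+x. f (S ** x) \<partial>lborel)"
    by (rule nn_integral_lborel_transpose) simp
  finally show ?thesis
    by (simp add: ennreal_power)
qed

lemma lborel_stack:
  "(lborel :: (real ^ 'm ^ ('k::finite + 'l::finite)) measure)
    = distr (lborel \<Otimes>\<^sub>M lborel) borel (\<lambda>(\<omega>, t). stack \<omega> t)"
proof (rule lborel_vec_eqI)
  interpret pair_sigma_finite "lborel :: (real ^ 'm ^ 'k) measure" "lborel :: (real ^ 'm ^ 'l) measure" ..
  fix l u :: "real ^ 'm ^ ('k + 'l)"
  have "(\<lambda>(\<omega>, t). stack \<omega> t) -` box l u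
      = box (\<chi> a. l $ Inl a) (\<chi> a. u $ Inl a) \<times> box (\<chi> b. l $ Inr b) (\<chi> b. u $ Inr b)"
    by (auto simp: mem_box_vec stack_def split_sum_all)
  then have "emeasure (distr (lborel \<Otimes>\<^sub>M lborel) borel (\<lambda>(\<omega>, t). stack \<omega> t)) (box l u)
     = (\<Prod>i\<in>UNIV. emeasure lborel (box (l $ Inl i) (u $ Inl i))) *
       (\<Prod>i\<in>UNIV. emeasure lborel (box (l $ Inr i) (u $ Inr i)))"
    by (subst emeasure_distr) (simp_all add: space_pair_measure lborel.emeasure_pair_measure_Times
        emeasure_lborel_box_vec)
  also have "\<dots> = (\<Prod>i\<in>UNIV. emeasure lborel (box (l $ i) (u $ i)))"
    by (simp add: prod.Plus flip: UNIV_Plus_UNIV)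
  finally show "emeasure (distr (lborel \<Otimes>\<^sub>M lborel) borel (\<lambda>(\<omega>, t). stack \<omega> t)) (box l u)
      = (\<Prod>i\<in>UNIV. emeasure lborel (box (l $ i) (u $ i)))" .
qed simp

text \<open>The split that separates the variable \<omega> along a plane from the variable t
  transversal to it.\<close>

lemma nn_integral_lborel_stack:
  fixes f :: "real ^ 'm ^ ('k::finite + 'l::finite) \<Rightarrow> ennreal"
  assumes [measurable]: "f \<in> borel_measurable borel"
  shows "(\<integral>\<^sup>+x. f x \<partial>lborel) = (\<integral>\<^sup>+t. \<integral>\<^sup>+\<omega>. f (stack \<omega> t) \<partial>lborel \<partial>lborel)"
proof -
  interpret pair_sigma_finite "lborel :: (real ^ 'm ^ 'k) measure" "lborel :: (real ^ 'm ^ 'l) measure" ..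
  show ?thesis
    by (subst lborel_stack) (simp add: nn_integral_distr split_beta' flip: lborel_pair.nn_integral_snd)
qed

subsection \<open>Rank-one perturbations of the identity\<close>

definition outer :: "real ^ 'n \<Rightarrow> real ^ 'n ^ 'n" where
  "outer y = (\<chi> i j. y $ i * y $ j)"

lemma outer_matrix_mult: "outer (S *v y) = S ** outer y ** transpose S"
proof -
  have "(\<Sum>a\<in>UNIV. S $ i $ a * y $ a) * (\<Sum>b\<in>UNIV. S $ j $ b * y $ b)
      = (\<Sum>b\<in>UNIV. (\<Sum>a\<in>UNIV. S $ i $ a * (y $ a * y $ b)) * S $ j $ b)" for i j
    unfolding sum_distrib_right sum_distrib_left
    by (intro sum.cong refl) (simp add: mult_ac)
  then show ?thesis
    by (simp add: outer_def matrix_matrix_mult_def matrix_vector_mult_def vec_eq_iff transpose_def)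
qed

lemma sum_outer_rows: "(\<Sum>i\<in>UNIV. outer (x $ i)) = transpose x ** x"
  by (simp add: outer_def matrix_matrix_mult_def vec_eq_iff transpose_def)

lemma matrix_add_rdistrib: "(A + B) ** C = A ** C + B ** (C :: real ^ 'n ^ 'm)"
  by (simp add: matrix_matrix_mult_def vec_eq_iff distrib_right sum.distrib)

lemma matrix_scaleR_mult_left: "(c *\<^sub>R A) ** B = c *\<^sub>R (A ** (B :: real ^ 'n ^ 'm))"
  by (simp add: matrix_matrix_mult_def vec_eq_iff sum_distrib_left mult.assoc)

lemma matrix_scaleR_mult_right: "A ** (c *\<^sub>R B) = c *\<^sub>R (A ** (B :: real ^ 'n ^ 'm))"
  by (simp add: matrix_matrix_mult_def vec_eq_iff sum_distrib_left mult.left_commute)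

text \<open>A rotation carrying a coordinate axis to the direction of \<open>z\<close> reduces the
  claim to a diagonal matrix with one entry different from 1.\<close>

lemma det_one_add_outer: "det (mat 1 + outer z) = 1 + (norm z)\<^sup>2"
proof (cases "z = 0")
  case True
  then have "outer z = 0"
    by (simp add: outer_def vec_eq_iff)
  then show ?thesis
    using True by simp
next
  case False
  fix k :: 'a
  obtain Q where Q: "orthogonal_matrix Q" "Q *v axis k 1 = sgn z"
    using orthogonal_matrix_exists_basis[of "sgn z" k] False by (auto simp: norm_sgn)
  then have QQ: "Q ** transpose Q = mat 1" "transpose Q ** Q = mat 1"
    by (auto simp: orthogonal_matrix_def)
  have z: "z = Q *v (norm z *\<^sub>R axis k 1)"
    using Q False by (simp add: matrix_vector_mult_scaleR sgn_div_norm)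
  define E where "E = mat 1 + outer (norm z *\<^sub>R axis k 1 :: real ^ 'a)"
  have "mat 1 + outer z = Q ** E ** transpose Q"
    by (subst z, subst outer_matrix_mult)
      (simp add: E_def matrix_add_ldistrib matrix_add_rdistrib QQ)
  then have "det (mat 1 + outer z) = det E * det (transpose Q ** Q)"
    by (simp add: det_mul)
  also have "\<dots> = det E"
    by (simp add: QQ)
  also have "\<dots> = (\<Prod>i\<in>UNIV. E $ i $ i)"
    by (rule det_diagonal) (auto simp: E_def outer_def mat_def axis_def)
  also have "\<dots> = (\<Prod>i\<in>UNIV. if i = k then 1 + (norm z)\<^sup>2 else 1)"
    by (rule prod.cong) (auto simp: E_def outer_def mat_def axis_def power2_eq_square)
  finally show ?thesis
    by simp
qed

text \<open>An explicit symmetric square root: \<open>c\<close> is chosen so that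
  \<open>2 * c + c\<^sup>2 * (norm z)\<^sup>2 = 1\<close>, which is the coefficient of
  \<open>outer z\<close> in the square.\<close>

lemma square_one_add_outer:
  fixes z :: "real ^ 'n"
  defines "c \<equiv> 1 / (1 + sqrt (1 + (norm z)\<^sup>2))"
  shows "(mat 1 + c *\<^sub>R outer z) ** transpose (mat 1 + c *\<^sub>R outer z) = mat 1 + outer z"
proof -
  define q where "q = sqrt (1 + (norm z)\<^sup>2)"
  have "q \<ge> 0" and q2: "(norm z)\<^sup>2 = q * q - 1"
    by (simp_all add: q_def)
  then have "c * (1 + q) = 1"
    by (simp add: c_def q_def[symmetric])
  then have c: "c + c + c * (c * (norm z)\<^sup>2) = 1"
    unfolding q2 by algebra
  have sym: "transpose (outer z) = outer z" "transpose (mat 1 + c *\<^sub>R outer z) = mat 1 + c *\<^sub>R outer z"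
    by (simp_all add: outer_def transpose_def vec_eq_iff mat_def mult_ac)
  have "outer z ** outer z = (norm z)\<^sup>2 *\<^sub>R outer z"
    by (simp add: outer_def matrix_matrix_mult_def vec_eq_iff dot_square_norm[symmetric] inner_vec_def
        sum_distrib_left sum_distrib_right mult_ac)
  then have "(mat 1 + c *\<^sub>R outer z) ** (mat 1 + c *\<^sub>R outer z)
      = mat 1 + (c *\<^sub>R outer z + c *\<^sub>R outer z + (c * (c * (norm z)\<^sup>2)) *\<^sub>R outer z)"
    by (simp add: matrix_add_ldistrib matrix_add_rdistrib matrix_scaleR_mult_left matrix_scaleR_mult_right scaleR_right_distrib)
  also have "\<dots> = mat 1 + (c + c + c * (c * (norm z)\<^sup>2)) *\<^sub>R outer z"
    by (simp only: scaleR_left_distrib)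
  finally have "(mat 1 + c *\<^sub>R outer z) ** (mat 1 + c *\<^sub>R outer z)
      = mat 1 + (c + c + c * (c * (norm z)\<^sup>2)) *\<^sub>R outer z" .
  then show ?thesis
    by (simp only: sym c scaleR_one)
qed

text \<open>Built up one summand at a time: if the matrix so far is \<open>BB'\<close> and
  \<open>z\<close> solves \<open>Bz = r\<close>, then \<open>BB' + rr' = B(I + zz')B'\<close>, and
  the middle factor has an explicit square root.\<close>

lemma one_add_sum_outer_factor:
  assumes "finite S"
  obtains B :: "real ^ 'n ^ 'n" where "mat 1 + (\<Sum>i\<in>S. outer (r i)) = B ** transpose B" "det B \<noteq> 0"
proof -
  have "\<exists>B :: real ^ 'n ^ 'n. mat 1 + (\<Sum>i\<in>S. outer (r i)) = B ** transpose B \<and> det B \<noteq> 0"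
    using assms
  proof induction
    case empty
    show ?case
      by (rule exI[of _ "mat 1"]) simp
  next
    case (insert i S)
    then obtain B :: "real ^ 'n ^ 'n"
      where B: "mat 1 + (\<Sum>i\<in>S. outer (r i)) = B ** transpose B" "det B \<noteq> 0"
      by blast
    then obtain T where T: "B ** T = mat 1"
      using invertible_det_nz[of B] by (auto simp: invertible_def)
    define z where "z = T *v r i"
    define C where "C = mat 1 + (1 / (1 + sqrt (1 + (norm z)\<^sup>2))) *\<^sub>R outer z"
    have C: "C ** transpose C = mat 1 + outer z"
      unfolding C_def by (rule square_one_add_outer)
    have "outer (r i) = B ** outer z ** transpose B"
      by (simp add: z_def matrix_vector_mul_assoc T flip: outer_matrix_mult)
    then have "mat 1 + (\<Sum>i\<in>insert i S. outer (r i)) = B ** transpose B + B ** outer z ** transpose B"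
      using insert B by (simp add: add_ac)
    also have "\<dots> = B ** (C ** transpose C) ** transpose B"
      by (simp add: C matrix_add_ldistrib matrix_add_rdistrib)
    also have "\<dots> = (B ** C) ** transpose (B ** C)"
      by (simp add: matrix_transpose_mul matrix_mul_assoc)
    finally have eq: "mat 1 + (\<Sum>i\<in>insert i S. outer (r i)) = (B ** C) ** transpose (B ** C)" .
    have "det C * det C = 1 + (norm z)\<^sup>2"
      using arg_cong[OF C, of det] by (simp add: det_mul det_one_add_outer)
    moreover have "0 < 1 + (norm z)\<^sup>2"
      by (simp add: add_pos_nonneg)
    ultimately have "det C \<noteq> 0"
      by auto
    then show ?case
      using eq B(2) by (metis det_mul mult_eq_0_iff)
  qed
  then show thesis
    using that by blast
qed

lemma det_add_outer:
  fixes B :: "real ^ 'n ^ 'n"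
  assumes "A = B ** transpose B" "B ** T = mat 1"
  shows "det (A + outer y) = (det B)\<^sup>2 * (1 + (norm (T *v y))\<^sup>2)"
proof -
  have "A + outer y = B ** (mat 1 + outer (T *v y)) ** transpose B"
    using assms by (simp add: matrix_add_ldistrib matrix_add_rdistrib matrix_vector_mul_assoc
        flip: outer_matrix_mult)
  then show ?thesis
    by (simp add: det_mul det_one_add_outer power2_eq_square)
qed

text \<open>By \<open>det_add_outer\<close>, each further summand multiplies the determinant by a
  factor of the form \<open>1 + (norm (T *v y))\<^sup>2\<close>.\<close>

lemma det_one_add_sum_outer_mono:
  fixes r :: "'i \<Rightarrow> real ^ 'n"
  assumes "finite S'" "S \<subseteq> S'"
  shows "det (mat 1 + (\<Sum>i\<in>S. outer (r i))) \<le> det (mat 1 + (\<Sum>i\<in>S'. outer (r i)))"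
proof -
  have "det (mat 1 + (\<Sum>i\<in>S. outer (r i))) \<le> det (mat 1 + (\<Sum>i\<in>S \<union> R. outer (r i)))"
    if "finite R" "R \<inter> S = {}" for R
    using that
  proof induction
    case (insert j R)
    have fin: "finite (S \<union> R)"
      using assms insert(1) finite_subset by blast
    obtain B where B: "mat 1 + (\<Sum>i\<in>S \<union> R. outer (r i)) = B ** transpose B" "det B \<noteq> 0"
      using one_add_sum_outer_factor[OF fin] by blast
    then obtain T where T: "B ** T = mat 1"
      using invertible_det_nz[of B] by (auto simp: invertible_def)
    have eq: "mat 1 + (\<Sum>i\<in>S \<union> insert j R. outer (r i)) = (mat 1 + (\<Sum>i\<in>S \<union> R. outer (r i))) + outer (r j)"
      using insert fin by (simp add: add_ac)
    have "det (mat 1 + (\<Sum>i\<in>S \<union> insert j R. outer (r i))) = (det B)\<^sup>2 * (1 + (norm (T *v r j))\<^sup>2)"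
      unfolding eq by (rule det_add_outer[OF B(1) T])
    moreover have "det (mat 1 + (\<Sum>i\<in>S \<union> R. outer (r i))) = (det B)\<^sup>2"
      by (simp add: B(1) det_mul power2_eq_square)
    ultimately show ?case
      using insert by (simp add: distrib_left order_trans)
  qed simp
  moreover have "S \<union> (S' - S) = S'"
    using assms by blast
  ultimately show ?thesis
    using assms by (metis Diff_disjoint finite_Diff inf_commute)
qed

lemma det_one_add_sum_outer_ge_1:
  fixes r :: "'i \<Rightarrow> real ^ 'n"
  assumes "finite S"
  shows "1 \<le> det (mat 1 + (\<Sum>i\<in>S. outer (r i)))"
  using det_one_add_sum_outer_mono[OF assms, of "{}" r] by simp

lemma gram_det_eq: "gram_det x = det (mat 1 + (\<Sum>i\<in>UNIV. outer (x $ i)))"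
  using det_one_add_sum_outer_ge_1[of UNIV "($) x"]
  by (simp add: gram_det_def flip: sum_outer_rows)

lemma gram_det_ge_1: "1 \<le> gram_det x"
  by (simp add: gram_det_eq det_one_add_sum_outer_ge_1)

lemma gram_det_stack_ge: "gram_det \<omega> \<le> gram_det (stack \<omega> t)"
proof -
  have "gram_det \<omega> = det (mat 1 + (\<Sum>i\<in>range Inl. outer (stack \<omega> t $ i)))"
    by (simp add: gram_det_eq sum.reindex stack_def)
  also have "\<dots> \<le> gram_det (stack \<omega> t)"
    unfolding gram_det_eq by (rule det_one_add_sum_outer_mono) auto
  finally show ?thesis .
qed

lemma gram_det_orthogonal:
  assumes "orthogonal_matrix g"
  shows "gram_det (g ** x) = gram_det x"
proof -
  have "transpose (g ** x) ** (g ** x) = transpose x ** (transpose g ** g) ** x"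
    by (simp add: matrix_transpose_mul matrix_mul_assoc)
  then show ?thesis
    using assms by (simp add: gram_det_def orthogonal_matrix)
qed

subsection \<open>Orthogonal matrices\<close>

text \<open>The columns of \<xi> are orthonormal. They are completed to an orthogonal basis, whose
  new members, once normalized, become the first \<open>k\<close> columns of
  \<open>g\<close>.\<close>

lemma exists_orthogonal_matrix_frame:
  fixes \<xi> :: "real ^ 'l ^ ('k::finite + 'l::finite)"
  assumes "transpose \<xi> ** \<xi> = mat 1"
  obtains g where "orthogonal_matrix g" "g ** stiefel_base = \<xi>"
proof -
  have inner_col: "column a \<xi> \<bullet> column b \<xi> = (if a = b then 1 else 0)" for a b
    using assms by (simp add: matrix_mult_transpose_dot_column vec_eq_iff mat_def)
  define C where "C = range (\<lambda>b. column b \<xi>)"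
  have inj: "inj (\<lambda>b. column b \<xi>)"
    by (rule injI) (metis inner_col zero_neq_one)
  have C: "pairwise orthogonal C" "finite C" "card C = CARD('l)" "0 \<notin> C"
    using inner_col inj
    by (auto simp: C_def pairwise_def orthogonal_def card_image) (metis inner_zero_left zero_neq_one)
  \<comment> \<open>Disjointness from \<open>insert 0 C\<close> keeps 0 out of \<open>U\<close>, so
    that its elements can be normalized.\<close>
  obtain U where U: "U \<inter> insert 0 C = {}" "pairwise orthogonal (C \<union> U)" "span (C \<union> U) = span (C \<union> UNIV)"
    using orthogonal_extension_strong[OF C(1)] .
  have indep: "independent (C \<union> U)"
    using U C(4) by (intro pairwise_orthogonal_independent) auto
  then have "finite (C \<union> U)"
    by (rule independent_imp_finite)
  moreover have "card (C \<union> U) = CARD('k + 'l)"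
    using indep U(3) by (auto simp: dim_eq_card_independent[symmetric]
        dim_span[symmetric, of "C \<union> U"] simp del: dim_span)
  ultimately have "finite U" "card U = CARD('k)"
    using U(1) C(2,3) card_Un_disjoint[of C U] by (auto simp: inf_commute)
  then obtain h where h: "bij_betw h (UNIV :: 'k set) U"
    by (metis finite_class.finite_UNIV finite_same_card_bij)
  define c where "c i = (case i of Inl a \<Rightarrow> sgn (h a) | Inr b \<Rightarrow> column b \<xi>)" for i
  have hU: "h a \<in> U" for a
    using h by (auto simp: bij_betw_def)
  then have "h a \<noteq> 0" for a
    using U(1) by (metis IntI empty_iff insertI1)
  then have "norm (c i) = 1" for i
    by (cases i) (simp_all add: c_def norm_sgn norm_eq_1 inner_col)
  moreover have "orthogonal (c i) (c j)" if "i \<noteq> j" for i j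
  proof -
    have 1: "orthogonal (h a) (h b)" if "a \<noteq> b" for a b
      using that h hU U(2) by (metis UnCI bij_betw_def injD pairwise_def)
    have 2: "orthogonal (h a) (column b \<xi>)" for a b
      using hU[of a] U(1,2) by (auto simp: pairwise_def C_def) (metis IntI UnCI empty_iff insertI2 rangeI)
    show ?thesis
      using that 1 2 inner_col
      by (cases i; cases j) (auto simp: c_def sgn_div_norm orthogonal_def inner_commute)
  qed
  ultimately have "orthogonal_matrix (\<chi> i j. c j $ i)"
    by (simp add: orthogonal_matrix_orthonormal_columns column_def)
  moreover have "(\<chi> i j. c j $ i) ** stiefel_base = \<xi>"
    by (simp add: vec_eq_iff matrix_matrix_mult_def stiefel_base_def stack_def sum.Plus mat_def
        c_def column_def if_distrib cong: if_cong flip: UNIV_Plus_UNIV)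
  ultimately show thesis
    using that by blast
qed

text \<open>If the orthogonal completion has determinant -1, composing it with a reflection in one
  of the first \<open>k\<close> coordinates repairs the sign. The reflection fixes the base frame,
  whose first \<open>k\<close> rows vanish.\<close>

lemma frame_rotation:
  fixes \<xi> :: "real ^ 'l ^ ('k::finite + 'l::finite)"
  assumes "\<xi> \<in> stiefel"
  shows "orthogonal_matrix (frame_rotation \<xi>)" "frame_rotation \<xi> ** stiefel_base = \<xi>"
proof -
  have "\<exists>g. rotation_matrix g \<and> g ** stiefel_base = \<xi>"
  proof -
    obtain g where g: "orthogonal_matrix g" "g ** stiefel_base = \<xi>"
      using exists_orthogonal_matrix_frame assms by (auto simp: stiefel_def)
    fix a :: 'k
    define E :: "real ^ ('k + 'l) ^ ('k + 'l)"
      where "E = (\<chi> i j. if i = j then if i = Inl a then -1 else 1 else 0)"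
    have "det E = (\<Prod>i\<in>UNIV. E $ i $ i)"
      by (rule det_diagonal) (simp add: E_def)
    then have "det E = -1"
      by (simp add: E_def)
    moreover have "orthogonal_matrix E"
      by (auto simp: orthogonal_matrix vec_eq_iff matrix_matrix_mult_def transpose_def E_def mat_def
          if_distrib[of "\<lambda>x. x * _"] cong: if_cong)
    moreover have "E ** stiefel_base = (stiefel_base :: real ^ 'l ^ ('k + 'l))"
      by (auto simp: vec_eq_iff matrix_matrix_mult_def E_def stiefel_base_def stack_def
          if_distrib[of "\<lambda>x. x * _"] cong: if_cong split: sum.split)
    ultimately show ?thesis
      using g det_orthogonal_matrix[OF g(1)]
      by (intro exI[of _ "if det g = 1 then g else g ** E"])
         (auto simp: rotation_matrix_def det_mul orthogonal_matrix_mul simp flip: matrix_mul_assoc)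
  qed
  then have "rotation_matrix (frame_rotation \<xi>) \<and> frame_rotation \<xi> ** stiefel_base = \<xi>"
    unfolding frame_rotation_def by (rule someI_ex)
  then show "orthogonal_matrix (frame_rotation \<xi>)" "frame_rotation \<xi> ** stiefel_base = \<xi>"
    by (auto simp: rotation_matrix_def)
qed

lemma compact_orthogonal_matrices: "compact {v :: real ^ 'n ^ 'n. orthogonal_matrix v}"
proof -
  have "norm v \<le> (\<Sum>i\<in>(UNIV :: 'n set). 1)" if "orthogonal_matrix v" for v :: "real ^ 'n ^ 'n"
  proof -
    have "norm (v $ i) = 1" for i
      using that by (simp add: orthogonal_matrix_orthonormal_rows row_def)
    then show ?thesis
      using L2_set_le_sum[of UNIV "\<lambda>i. norm (v $ i)"] by (simp add: norm_vec_def)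
  qed
  then have "bounded {v :: real ^ 'n ^ 'n. orthogonal_matrix v}"
    by (intro boundedI) auto
  moreover have "closed {v :: real ^ 'n ^ 'n. orthogonal_matrix v}"
    unfolding orthogonal_matrix matrix_matrix_mult_def transpose_def
    by (intro closed_Collect_eq continuous_intros)
  ultimately show ?thesis
    by (simp add: compact_eq_bounded_closed)
qed

text \<open>
  If \<open>v\<close> maximizes \<open>tr (vM)\<close> over the orthogonal group, then \<open>vM\<close> is symmetric, since plane rotations cannot
  increase the trace. This replaces the polar decomposition of \<open>M\<close>.
\<close>

lemma exists_orthogonal_symmetrizer:
  fixes M :: "real ^ 'n ^ 'n"
  obtains v where "orthogonal_matrix v" "transpose M = v ** M ** v"
proof -
  let ?K = "{v :: real ^ 'n ^ 'n. orthogonal_matrix v}"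
  have "continuous_on ?K (\<lambda>v. trace (v ** M))"
    unfolding trace_def matrix_matrix_mult_def by (intro continuous_intros)
  moreover have "?K \<noteq> {}"
    using orthogonal_matrix_id by blast
  ultimately obtain v where v: "orthogonal_matrix v"
    and max: "\<And>w. orthogonal_matrix w \<Longrightarrow> trace (w ** M) \<le> trace (v ** M)"
    using continuous_attains_sup[OF compact_orthogonal_matrices] by fastforce
  define s where "s = v ** M"
  have "s $ i $ j = s $ j $ i" if "i \<noteq> j" for i j
  proof -
    define A B where "A = s $ i $ i + s $ j $ j" and "B = s $ j $ i - s $ i $ j"
    \<comment> \<open>The left side is the change of the trace when \<open>s\<close> is multiplied
      by the rotation by \<theta> in the plane of coordinates \<open>i\<close> and \<open>j\<close>.
      It is maximal at \<theta> = 0, so its derivative there, which is \<open>B\<close>,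
      vanishes.\<close>
    have le: "(cos \<theta> - 1) * A + sin \<theta> * B \<le> 0" for \<theta>
    proof -
      \<comment> \<open>The plane rotation, written as the identity plus corrections in the two
        affected coordinates.\<close>
      define f where "f x = x + ((cos \<theta> - 1) * x $ i + sin \<theta> * x $ j) *\<^sub>R axis i 1
        + ((cos \<theta> - 1) * x $ j - sin \<theta> * x $ i) *\<^sub>R axis j 1" for x :: "real ^ 'n"
      have lin: "linear f"
        by (rule linearI) (simp_all add: f_def algebra_simps)
      have "norm (f x) = norm x" for x
      proof -
        define p q where "p = (cos \<theta> - 1) * x $ i + sin \<theta> * x $ j"
          and "q = (cos \<theta> - 1) * x $ j - sin \<theta> * x $ i"
        have "f x = x + p *\<^sub>R axis i 1 + q *\<^sub>R axis j 1"
          by (simp add: f_def p_def q_def)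
        moreover have "axis i 1 $ j = (0 :: real)" "axis j 1 $ i = (0 :: real)"
          "axis i 1 $ i = (1 :: real)" "axis j 1 $ j = (1 :: real)"
          using \<open>i \<noteq> j\<close> by (simp_all add: axis_def)
        ultimately have "f x \<bullet> f x = x \<bullet> x + 2 * p * x $ i + 2 * q * x $ j + p * p + q * q"
          by (simp add: inner_left_distrib inner_right_distrib inner_axis inner_axis' algebra_simps)
        also have "\<dots> = x \<bullet> x + ((sin \<theta>)\<^sup>2 + (cos \<theta>)\<^sup>2 - 1) * ((x $ i)\<^sup>2 + (x $ j)\<^sup>2)"
          unfolding p_def q_def by algebra
        finally show ?thesis
          by (simp add: norm_eq)
      qed
      then have "orthogonal_matrix (matrix f)"
        using lin orthogonal_transformation_matrix orthogonal_transformation by blast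
      then have "trace (matrix f ** v ** M) \<le> trace s"
        unfolding s_def by (intro max orthogonal_matrix_mul v)
      moreover have "trace (matrix f ** s) = (\<Sum>b\<in>UNIV. f (column b s) $ b)"
        unfolding trace_def
      proof (rule sum.cong[OF refl])
        fix b
        have "f (column b s) $ b = (matrix f *v column b s) $ b"
          using matrix_works[of f "column b s"] lin by simp
        then show "(matrix f ** s) $ b $ b = f (column b s) $ b"
          by (simp add: matrix_matrix_mult_def matrix_vector_mult_def column_def)
      qed
      moreover have "(\<Sum>b\<in>UNIV. f (column b s) $ b) = trace s + ((cos \<theta> - 1) * A + sin \<theta> * B)"
      proof -
        have "f (column b s) $ b = s $ b $ b
            + (if b = i then (cos \<theta> - 1) * s $ i $ i + sin \<theta> * s $ j $ i else 0)
            + (if b = j then (cos \<theta> - 1) * s $ j $ j - sin \<theta> * s $ i $ j else 0)" for b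
          by (simp add: f_def column_def axis_def)
        then show ?thesis
          by (simp add: trace_def sum.distrib A_def B_def algebra_simps)
      qed
      ultimately show ?thesis
        by (simp add: s_def matrix_mul_assoc)
    qed
    have "((\<lambda>\<theta>. (cos \<theta> - 1) * A + sin \<theta> * B) has_real_derivative B) (at 0)"
      by (auto intro!: derivative_eq_intros)
    then have "B = 0"
      by (rule DERIV_local_max[where d = 1]) (use le in auto)
    then show ?thesis
      by (simp add: B_def)
  qed
  then have "transpose s = s"
    by (metis (mono_tags, lifting) transpose_def vec_eq_iff vec_lambda_beta)
  then have "transpose M ** transpose v = v ** M"
    by (simp add: s_def matrix_transpose_mul)
  then have "transpose M ** (transpose v ** v) = v ** M ** v"
    by (simp add: matrix_mul_assoc)
  then have "transpose M = v ** M ** v"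
    using v by (simp add: orthogonal_matrix)
  then show thesis
    using that v by blast
qed

subsection \<open>Sylvester's determinant identity\<close>

text \<open>The embedding of square matrices that acts as \<open>A\<close> on the coordinates in the
  range of an injection and as the identity on the rest. With \<open>Inl\<close> and
  \<open>Inr\<close> it yields the two kinds of block-diagonal matrices needed below.\<close>

definition extend_matrix :: "('m::finite \<Rightarrow> 'p::finite) \<Rightarrow> real ^ 'm ^ 'm \<Rightarrow> real ^ 'p ^ 'p" where
  "extend_matrix \<iota> A = (\<chi> i j. if i \<in> range \<iota> \<and> j \<in> range \<iota> then A $ inv \<iota> i $ inv \<iota> j else of_bool (i = j))"

lemma extend_matrix_mult:
  assumes "inj \<iota>"
  shows "extend_matrix \<iota> (A ** B) = extend_matrix \<iota> A ** extend_matrix \<iota> B"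
proof -
  have "(\<Sum>k\<in>UNIV. extend_matrix \<iota> A $ i $ k * extend_matrix \<iota> B $ k $ j) = extend_matrix \<iota> (A ** B) $ i $ j"
    for i j
  proof (cases "i \<in> range \<iota>")
    case True
    then have "(\<Sum>k\<in>UNIV. extend_matrix \<iota> A $ i $ k * extend_matrix \<iota> B $ k $ j)
        = (\<Sum>k\<in>range \<iota>. extend_matrix \<iota> A $ i $ k * extend_matrix \<iota> B $ k $ j)"
      by (intro sum.mono_neutral_right) (auto simp: extend_matrix_def)
    also have "\<dots> = (\<Sum>k\<in>UNIV. extend_matrix \<iota> A $ i $ \<iota> k * extend_matrix \<iota> B $ \<iota> k $ j)"
      by (simp add: sum.reindex assms)
    also have "\<dots> = extend_matrix \<iota> (A ** B) $ i $ j"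
    proof (cases "j \<in> range \<iota>")
      case False
      then have "of_bool (\<iota> k = j) = (0 :: real)" for k
        by auto
      with True False assms show ?thesis
        by (auto simp: extend_matrix_def)
    qed (use True assms in \<open>auto simp: extend_matrix_def matrix_matrix_mult_def\<close>)
    finally show ?thesis .
  next
    case False
    then have "(\<Sum>k\<in>UNIV. extend_matrix \<iota> A $ i $ k * extend_matrix \<iota> B $ k $ j)
        = (\<Sum>k\<in>{i}. extend_matrix \<iota> A $ i $ k * extend_matrix \<iota> B $ k $ j)"
      by (intro sum.mono_neutral_right) (auto simp: extend_matrix_def)
    then show ?thesis
      using False by (simp add: extend_matrix_def)
  qed
  then show ?thesis
    by (simp add: matrix_matrix_mult_def vec_eq_iff)
qed

text \<open>The embedding is multiplicative and turns elementary matrices into elementary matrices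
  of the same kind, with indices moved by the injection.\<close>

lemma det_extend_matrix:
  assumes inj: "inj \<iota>"
  shows "det (extend_matrix \<iota> A) = det A"
proof (induction A rule: induct_matrix_elementary)
  case (1 A B)
  then show ?case
    by (simp add: extend_matrix_mult inj det_mul)
next
  case (2 A i)
  then have "row (\<iota> i) (extend_matrix \<iota> A) = 0"
    by (auto simp: row_def extend_matrix_def vec_eq_iff inj)
  with 2 show ?case
    by (simp add: det_zero_row)
next
  case (3 A)
  then have "det (extend_matrix \<iota> A) = (\<Prod>i\<in>UNIV. extend_matrix \<iota> A $ i $ i)"
    using inj by (intro det_diagonal) (auto simp: extend_matrix_def intro!: 3)
  also have "\<dots> = (\<Prod>i\<in>range \<iota>. extend_matrix \<iota> A $ i $ i)"
    by (intro prod.mono_neutral_right) (auto simp: extend_matrix_def)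
  also have "\<dots> = det A"
    using 3 by (subst det_diagonal) (simp_all add: prod.reindex inj extend_matrix_def)
  finally show ?case .
next
  case (4 m n)
  have "extend_matrix \<iota> (\<chi> i j. mat 1 $ i $ Transposition.transpose m n j)
      = (\<chi> i j. mat 1 $ i $ Transposition.transpose (\<iota> m) (\<iota> n) j)"
    using 4 inj by (auto simp: vec_eq_iff extend_matrix_def mat_def Transposition.transpose_def inj_eq)
  then show ?case
    using 4 inj by (simp add: det_swap_matrix inj_eq)
next
  case (5 m n c)
  have "extend_matrix \<iota> (\<chi> i j. if i = m \<and> j = n then c else of_bool (i = j))
      = (\<chi> i j. if i = \<iota> m \<and> j = \<iota> n then c else of_bool (i = j))"
    using 5 inj by (auto simp: vec_eq_iff extend_matrix_def inj_eq)
  then show ?case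
    using 5 inj by (simp add: det_shear_matrix inj_eq)
qed

definition block_matrix :: "real ^ 'a ^ 'a \<Rightarrow> real ^ 'b ^ 'a \<Rightarrow> real ^ 'a ^ 'b \<Rightarrow> real ^ 'b ^ 'b
    \<Rightarrow> real ^ ('a::finite + 'b::finite) ^ ('a + 'b)" where
  "block_matrix A B C D = (\<chi> i j. case i of
     Inl a \<Rightarrow> (case j of Inl b \<Rightarrow> A $ a $ b | Inr b \<Rightarrow> B $ a $ b)
   | Inr a \<Rightarrow> (case j of Inl b \<Rightarrow> C $ a $ b | Inr b \<Rightarrow> D $ a $ b))"

lemma block_matrix_mult:
  "block_matrix A B C D ** block_matrix A' B' C' D'
    = block_matrix (A ** A' + B ** C') (A ** B' + B ** D') (C ** A' + D ** C') (C ** B' + D ** D')"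
  by (simp add: vec_eq_iff matrix_matrix_mult_def block_matrix_def sum.Plus flip: UNIV_Plus_UNIV split: sum.split)

lemma det_block_left:
  "det (block_matrix A 0 0 (mat 1) :: real ^ ('a::finite + 'b::finite) ^ ('a + 'b)) = det (A :: real ^ 'a ^ 'a)"
proof -
  have "(block_matrix A 0 0 (mat 1) :: real ^ ('a::finite + 'b::finite) ^ ('a + 'b)) = extend_matrix Inl A"
    by (auto simp: vec_eq_iff block_matrix_def extend_matrix_def mat_def split: sum.split)
  then show ?thesis
    by (simp add: det_extend_matrix)
qed

lemma det_block_right:
  "det (block_matrix (mat 1) 0 0 D :: real ^ ('a::finite + 'b::finite) ^ ('a + 'b)) = det (D :: real ^ 'b ^ 'b)"
proof -
  have "(block_matrix (mat 1) 0 0 D :: real ^ ('a::finite + 'b::finite) ^ ('a + 'b)) = extend_matrix Inr D"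
    by (auto simp: vec_eq_iff block_matrix_def extend_matrix_def mat_def split: sum.split)
  then show ?thesis
    by (simp add: det_extend_matrix)
qed

lemma matrix_mult_minus:
  fixes A :: "real ^ 'c ^ 'd" and B :: "real ^ 'e ^ 'c"
  shows "A ** (- B) = - (A ** B)" "(- A) ** B = - (A ** B)"
  by (simp_all add: vec_eq_iff matrix_matrix_mult_def sum_negf)

lemma matrix_mult_zero:
  fixes A :: "real ^ 'c ^ 'd" and B :: "real ^ 'e ^ 'c"
  shows "A ** (0 :: real ^ 'e ^ 'c) = 0" "(0 :: real ^ 'c ^ 'd) ** B = 0"
  by (simp_all add: vec_eq_iff matrix_matrix_mult_def)

text \<open>These matrices turn addition of blocks into multiplication. Conjugation by
  \<open>J\<close> replaces \<open>X\<close> by \<open>- X\<close> without changing the determinant,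
  so its square is 1; halving \<open>X\<close> exhibits the determinant as a square, which excludes
  -1.\<close>

lemma det_block_unipotent:
  fixes X :: "real ^ 'b::finite ^ 'a::finite"
  shows "det (block_matrix (mat 1) X 0 (mat 1)) = 1"
proof -
  let ?U = "\<lambda>X :: real ^ 'b ^ 'a. block_matrix (mat 1) X 0 (mat 1)"
  have "?U X ** ?U Y = ?U (Y + X)" for X Y
    by (simp add: block_matrix_mult matrix_mult_zero)
  then have add: "det (?U (Y + X)) = det (?U X) * det (?U Y)" for X Y
    by (metis det_mul)
  define J :: "real ^ ('a + 'b) ^ ('a + 'b)" where "J = block_matrix (mat 1) 0 0 (- mat 1)"
  have one: "block_matrix (mat 1) 0 0 (mat 1) = (mat 1 :: real ^ ('a::finite + 'b::finite) ^ ('a + 'b))"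
    by (auto simp: vec_eq_iff block_matrix_def mat_def split: sum.split)
  have "J ** J = mat 1"
    by (simp add: J_def block_matrix_mult matrix_mult_minus matrix_mult_zero one)
  then have JJ: "det J * det J = 1"
    by (metis det_I det_mul)
  have "J ** ?U X ** J = ?U (- X)"
    by (simp add: J_def block_matrix_mult matrix_mult_minus matrix_mult_zero)
  then have "det (?U (- X)) = det J * det (?U X) * det J"
    by (metis det_mul)
  also have "\<dots> = det (?U X)"
    using JJ by algebra
  finally have "det (?U X) * det (?U X) = 1"
    using add[of X "- X"] by (simp add: one)
  moreover have "0 \<le> det (?U X)"
  proof -
    have "(1/2) *\<^sub>R X + (1/2) *\<^sub>R X = X"
      by (simp flip: scaleR_left_distrib)
    then show ?thesis
      using add[of "(1/2) *\<^sub>R X" "(1/2) *\<^sub>R X"] by simp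
  qed
  ultimately show ?thesis
    using square_eq_1_iff by fastforce
qed

text \<open>Two factorizations of the block matrix with rows \<open>(I, -x)\<close> and
  \<open>(x', I)\<close> are compared; all triangular factors have determinant 1.\<close>

lemma Sylvester_determinant:
  fixes x :: "real ^ 'm ^ 'n"
  shows "det (mat 1 + transpose x ** x) = det (mat 1 + x ** transpose x)"
proof -
  let ?U = "\<lambda>X :: real ^ 'm ^ 'n. block_matrix (mat 1) X 0 (mat 1)"
  let ?L = "block_matrix (mat 1) 0 (transpose x) (mat 1)"
  have "?L = transpose (?U x)"
    by (auto simp: vec_eq_iff block_matrix_def mat_def transpose_def split: sum.split)
  then have L: "det ?L = 1"
    by (simp add: det_block_unipotent)
  have "?L ** (block_matrix (mat 1) 0 0 (mat 1 + transpose x ** x) ** ?U (- x))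
      = ?U (- x) ** block_matrix (mat 1 + x ** transpose x) 0 0 (mat 1) ** ?L"
    by (simp add: block_matrix_mult matrix_mult_minus matrix_mult_zero)
  from arg_cong[OF this, of det] show ?thesis
    by (simp add: det_mul L det_block_left det_block_right det_block_unipotent)
qed

subsection \<open>Convergence of the Gram determinant integral\<close>

text \<open>The integrand is at most 1 on \<open>{-1..1}\<close> and at most
  \<open>\<bar>t\<bar> powr (- b)\<close> outside.\<close>

lemma nn_integral_Japanese_bracket_real:
  fixes b :: real
  assumes "b > 1"
  shows "(\<integral>\<^sup>+t. ennreal ((1 + t\<^sup>2) powr (- b / 2)) \<partial>lborel) < \<infinity>"
proof -
  let ?g = "\<lambda>t :: real. ennreal (if 1 \<le> t then t powr (- b) else 0)"
  have "((\<lambda>t. if t \<in> {1..} then t powr (- b) else 0) has_integral (- (1 powr (- b + 1)) / (- b + 1))) UNIV"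
    unfolding has_integral_restrict_UNIV using assms by (intro has_integral_powr_to_inf) auto
  then have "(\<integral>\<^sup>+t. ?g t \<partial>lborel) = ennreal (- (1 powr (- b + 1)) / (- b + 1))"
    by (intro nn_integral_has_integral_lborel) auto
  then have g: "(\<integral>\<^sup>+t. ?g t \<partial>lborel) < \<infinity>"
    by simp
  moreover have "(\<integral>\<^sup>+t. ?g (- t) \<partial>lborel) = (\<integral>\<^sup>+t. ?g t \<partial>lborel)"
    using nn_integral_real_affine[of ?g "-1" 0] by (simp only: add_0 mult_minus1 abs_minus_cancel abs_one) simp
  ultimately have g': "(\<integral>\<^sup>+t. ?g (- t) \<partial>lborel) < \<infinity>"
    by simp
  have "ennreal ((1 + t\<^sup>2) powr (- b / 2)) \<le> indicator {-1..1} t + ?g t + ?g (- t)" for t :: real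
  proof (cases "\<bar>t\<bar> \<le> 1")
    case True
    have "(1 + t\<^sup>2) powr (- b / 2) \<le> 1"
      using powr_mono2'[of "- b / 2" 1 "1 + t\<^sup>2"] assms by simp
    then have "ennreal ((1 + t\<^sup>2) powr (- b / 2)) \<le> indicator {-1..1} t"
      using True by (auto simp: indicator_def)
    then show ?thesis
      by (simp add: add_increasing2 add.assoc)
  next
    case False
    have "(1 + t\<^sup>2) powr (- b / 2) \<le> (\<bar>t\<bar> powr 2) powr (- b / 2)"
      using False assms by (intro powr_mono2') (auto simp: powr_numeral)
    also have "\<dots> = \<bar>t\<bar> powr (- b)"
      unfolding powr_powr by simp
    finally have "ennreal ((1 + t\<^sup>2) powr (- b / 2)) \<le> ?g \<bar>t\<bar>"
      using False by (simp add: ennreal_leI)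
    also have "\<dots> \<le> ?g t + ?g (- t)"
      by (auto simp: abs_if)
    finally show ?thesis
      by (simp add: add_increasing add.assoc)
  qed
  then have "(\<integral>\<^sup>+t. ennreal ((1 + t\<^sup>2) powr (- b / 2)) \<partial>lborel)
      \<le> (\<integral>\<^sup>+t. indicator {-1..1} t + ?g t + ?g (- t) \<partial>lborel)"
    by (rule nn_integral_mono)
  also have "\<dots> = emeasure lborel {-1..1::real} + (\<integral>\<^sup>+t. ?g t \<partial>lborel) + (\<integral>\<^sup>+t. ?g (- t) \<partial>lborel)"
    by (simp add: nn_integral_add)
  also have "\<dots> < \<infinity>"
    using g g' by (simp add: ennreal_add_eq_top less_top)
  finally show ?thesis .
qed

lemma nn_integral_prod_Japanese_bracket:
  fixes b :: real
  assumes "b > 1"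
  shows "(\<integral>\<^sup>+z. ennreal (\<Prod>i\<in>UNIV. (1 + (z $ i)\<^sup>2) powr (- b / 2)) \<partial>(lborel :: (real ^ 'n) measure)) < \<infinity>"
proof -
  have "(\<integral>\<^sup>+z. ennreal (\<Prod>i\<in>UNIV. (1 + (z $ i)\<^sup>2) powr (- b / 2)) \<partial>(lborel :: (real ^ 'n) measure))
      = (\<integral>\<^sup>+z. (\<Prod>i\<in>UNIV. ennreal ((1 + (z $ i)\<^sup>2) powr (- b / 2))) \<partial>(lborel :: (real ^ 'n) measure))"
    by (simp add: prod_ennreal)
  also have "\<dots> = (\<Prod>i\<in>(UNIV :: 'n set). \<integral>\<^sup>+t. ennreal ((1 + t\<^sup>2) powr (- b / 2)) \<partial>lborel)"
    by (rule nn_integral_lborel_vec_prod) simp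
  also have "\<dots> < \<infinity>"
    using nn_integral_Japanese_bracket_real[OF assms] by (simp add: power_less_top_ennreal)
  finally show ?thesis .
qed

text \<open>The exponent is shared equally among the coordinates. Each share \<open>b\<close>
  exceeds 1, and \<open>1 + (norm z)\<^sup>2\<close> dominates every
  \<open>1 + (z $ i)\<^sup>2\<close>, so a product of one-dimensional integrals majorizes.\<close>

lemma nn_integral_Japanese_bracket:
  fixes a :: real
  assumes "a > real CARD('n)"
  shows "(\<integral>\<^sup>+z. ennreal ((1 + (norm z)\<^sup>2) powr (- a / 2)) \<partial>(lborel :: (real ^ 'n) measure)) < \<infinity>"
proof -
  define b where "b = a / real CARD('n)"
  have "b > 1"
    using assms by (simp add: b_def)
  have "(1 + (norm z)\<^sup>2) powr (- a / 2) \<le> (\<Prod>i\<in>UNIV. (1 + (z $ i)\<^sup>2) powr (- b / 2))" for z :: "real ^ 'n"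
  proof -
    have pos: "0 < 1 + (norm z)\<^sup>2"
      by (simp add: add_pos_nonneg)
    have "(1 + (norm z)\<^sup>2) powr (- a / 2) = ((1 + (norm z)\<^sup>2) powr (- b / 2)) powr real CARD('n)"
      unfolding powr_powr by (simp add: b_def)
    also have "\<dots> = (\<Prod>i\<in>(UNIV :: 'n set). (1 + (norm z)\<^sup>2) powr (- b / 2))"
    proof -
      have "0 < (1 + (norm z)\<^sup>2) powr (- b / 2)"
        using pos by (simp only: powr_gt_zero)
      then show ?thesis
        by (simp only: powr_realpow prod_constant)
    qed
    also have "\<dots> \<le> (\<Prod>i\<in>UNIV. (1 + (z $ i)\<^sup>2) powr (- b / 2))"
    proof (rule prod_mono)
      fix i
      have "(z $ i)\<^sup>2 \<le> (norm z)\<^sup>2"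
        using component_le_norm_cart[of z i] by (simp flip: abs_le_square_iff)
      then show "0 \<le> (1 + (norm z)\<^sup>2) powr (- b / 2) \<and>
          (1 + (norm z)\<^sup>2) powr (- b / 2) \<le> (1 + (z $ i)\<^sup>2) powr (- b / 2)"
        using \<open>b > 1\<close> by (auto intro!: powr_mono2' add_pos_nonneg)
    qed
    finally show ?thesis .
  qed
  then show ?thesis
    by (intro le_less_trans[OF nn_integral_mono nn_integral_prod_Japanese_bracket[OF \<open>b > 1\<close>]] ennreal_leI)
qed

text \<open>Only finiteness matters, so \<open>exp (- s) \<le> 1 / (1 + s)\<close> in each
  coordinate reduces this to the bracket with exponent 2.\<close>

lemma nn_integral_exp_minus_norm_square:
  "(\<integral>\<^sup>+z. ennreal (exp (- (norm z)\<^sup>2)) \<partial>(lborel :: (real ^ 'n) measure)) < \<infinity>"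
proof -
  have "exp (- (norm z)\<^sup>2) \<le> (\<Prod>i\<in>UNIV. (1 + (z $ i)\<^sup>2) powr (- 2 / 2))" for z :: "real ^ 'n"
  proof -
    have "exp (- (norm z)\<^sup>2) = (\<Prod>i\<in>UNIV. exp (- (z $ i)\<^sup>2))"
      by (simp add: norm_vec_def L2_set_def sum_nonneg exp_sum flip: sum_negf)
    also have "\<dots> \<le> (\<Prod>i\<in>UNIV. (1 + (z $ i)\<^sup>2) powr (- 2 / 2))"
    proof (rule prod_mono)
      fix i
      have "inverse (exp ((z $ i)\<^sup>2)) \<le> inverse (1 + (z $ i)\<^sup>2)"
        by (intro le_imp_inverse_le) (auto simp: add_pos_nonneg)
      then show "0 \<le> exp (- (z $ i)\<^sup>2) \<and> exp (- (z $ i)\<^sup>2) \<le> (1 + (z $ i)\<^sup>2) powr (- 2 / 2)"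
        by (simp add: exp_minus powr_minus add_nonneg_nonneg)
    qed
    finally show ?thesis .
  qed
  moreover have "(1 :: real) < 2"
    by simp
  ultimately show ?thesis
    by (intro le_less_trans[OF nn_integral_mono nn_integral_prod_Japanese_bracket[of 2]] ennreal_leI)
qed

lemma borel_measurable_outer[measurable (raw)]:
  assumes [measurable]: "f \<in> borel_measurable M"
  shows "(\<lambda>x. outer (f x)) \<in> borel_measurable M"
  unfolding outer_def by measurable

lemma borel_measurable_gram_det[measurable (raw)]:
  assumes [measurable]: "f \<in> borel_measurable M"
  shows "(\<lambda>x. gram_det (f x)) \<in> borel_measurable M"
  unfolding gram_det_def by measurable

text \<open>The substitution \<open>y = Bz\<close> turns the determinant into
  \<open>(det B)\<^sup>2 * (1 + (norm z)\<^sup>2)\<close>. Its Jacobian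
  \<open>\<bar>det B\<bar>\<close> is \<open>det A\<close> to the power 1/2, which lowers
  \<open>a\<close> by one.\<close>

lemma nn_integral_det_one_add_outer:
  fixes B :: "real ^ 'm ^ 'm" and a :: real
  assumes A: "A = B ** transpose B" and "det B \<noteq> 0"
  shows "(\<integral>\<^sup>+y. ennreal (det (A + outer y) powr (- a / 2)) \<partial>lborel)
    = ennreal (det A powr (- (a - 1) / 2)) *
      (\<integral>\<^sup>+z. ennreal ((1 + (norm z)\<^sup>2) powr (- a / 2)) \<partial>(lborel :: (real ^ 'm) measure))"
proof -
  obtain T where T: "B ** T = mat 1" "T ** B = mat 1"
    using assms invertible_det_nz[of B] by (auto simp: invertible_def)
  have "(\<integral>\<^sup>+y. ennreal (det (A + outer y) powr (- a / 2)) \<partial>lborel)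
     = (\<integral>\<^sup>+y. ennreal (((det B)\<^sup>2 * (1 + (norm (T *v y))\<^sup>2)) powr (- a / 2)) \<partial>lborel)"
    by (simp add: det_add_outer[OF A T(1)])
  also have "\<dots> = ennreal \<bar>det B\<bar> *
      (\<integral>\<^sup>+z. ennreal (((det B)\<^sup>2 * (1 + (norm (T *v (B *v z)))\<^sup>2)) powr (- a / 2)) \<partial>lborel)"
    by (rule nn_integral_lborel_matrix_vector_mult) (use assms in simp_all)
  also have "\<dots> = ennreal \<bar>det B\<bar> *
      (\<integral>\<^sup>+z. ennreal (((det B)\<^sup>2) powr (- a / 2)) * ennreal ((1 + (norm z)\<^sup>2) powr (- a / 2))
        \<partial>(lborel :: (real ^ 'm) measure))"
    by (simp add: matrix_vector_mul_assoc T powr_mult flip: ennreal_mult)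
  also have "\<dots> = ennreal (\<bar>det B\<bar> * ((det B)\<^sup>2) powr (- a / 2)) *
      (\<integral>\<^sup>+z. ennreal ((1 + (norm z)\<^sup>2) powr (- a / 2)) \<partial>(lborel :: (real ^ 'm) measure))"
    by (simp add: nn_integral_cmult ennreal_mult mult.assoc)
  also have "\<bar>det B\<bar> * ((det B)\<^sup>2) powr (- a / 2) = ((det B)\<^sup>2) powr (1 / 2) * ((det B)\<^sup>2) powr (- a / 2)"
    by (simp add: powr_half_sqrt)
  also have "\<dots> = det A powr (- (a - 1) / 2)"
    using assms by (simp add: A det_mul power2_eq_square diff_divide_distrib flip: powr_add)
  finally show ?thesis .
qed

lemma nn_integral_PiM_det_one_add_sum_outer:
  fixes a :: real and S :: "'i set"
  assumes "finite S" "a > real (card S) + real CARD('m) - 1"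
  shows "(\<integral>\<^sup>+r. ennreal (det (mat 1 + (\<Sum>i\<in>S. outer (r i))) powr (- a / 2))
    \<partial>(\<Pi>\<^sub>M i\<in>S. (lborel :: (real ^ 'm) measure))) < \<infinity>"
  using assms
proof (induction S arbitrary: a rule: finite_induct)
  case empty
  interpret product_sigma_finite "\<lambda>_ :: 'i. lborel :: (real ^ 'm) measure" ..
  show ?case
    using nn_integral_empty[of "\<lambda>_. 1"] by simp
next
  case (insert i S)
  interpret product_sigma_finite "\<lambda>_ :: 'i. lborel :: (real ^ 'm) measure" ..
  define K where "K = (\<integral>\<^sup>+z. ennreal ((1 + (norm z)\<^sup>2) powr (- a / 2)) \<partial>(lborel :: (real ^ 'm) measure))"
  \<comment> \<open>The row set \<open>insert i S\<close> is nonempty, so the hypothesis on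
    \<open>a\<close> forces \<open>a > CARD('m)\<close>.\<close>
  have "K < \<infinity>"
    unfolding K_def using insert by (intro nn_integral_Japanese_bracket) simp
  let ?D = "\<lambda>S r. det (mat 1 + (\<Sum>i\<in>S. outer (r i)) :: real ^ 'm ^ 'm)"
  have "(\<integral>\<^sup>+r. ennreal (?D (insert i S) r powr (- a / 2)) \<partial>(\<Pi>\<^sub>M i\<in>insert i S. lborel))
      = (\<integral>\<^sup>+r. \<integral>\<^sup>+y. ennreal (?D (insert i S) (r(i := y)) powr (- a / 2)) \<partial>lborel \<partial>(\<Pi>\<^sub>M i\<in>S. lborel))"
    by (rule product_nn_integral_insert) (use insert in \<open>simp_all del: sum.insert\<close>)
  also have "\<dots> = (\<integral>\<^sup>+r. ennreal (?D S r powr (- (a - 1) / 2)) * K \<partial>(\<Pi>\<^sub>M i\<in>S. lborel))"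
  proof (rule nn_integral_cong)
    fix r :: "_ \<Rightarrow> real ^ 'm"
    obtain B :: "real ^ 'm ^ 'm"
      where B: "mat 1 + (\<Sum>i\<in>S. outer (r i)) = B ** transpose B" "det B \<noteq> 0"
      using one_add_sum_outer_factor[OF insert(1)] by blast
    have "(\<Sum>j\<in>S. outer ((r(i := y)) j)) = (\<Sum>j\<in>S. outer (r j))" for y
      using insert by (intro sum.cong) auto
    then have "(\<Sum>j\<in>insert i S. outer ((r(i := y)) j)) = (\<Sum>j\<in>S. outer (r j)) + outer y" for y
      using insert by (simp add: add.commute del: fun_upd_apply) simp
    then show "(\<integral>\<^sup>+y. ennreal (?D (insert i S) (r(i := y)) powr (- a / 2)) \<partial>lborel)
        = ennreal (?D S r powr (- (a - 1) / 2)) * K"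
      unfolding K_def using nn_integral_det_one_add_outer[OF B] by (simp add: add.assoc)
  qed
  also have "\<dots> = (\<integral>\<^sup>+r. ennreal (?D S r powr (- (a - 1) / 2)) \<partial>(\<Pi>\<^sub>M i\<in>S. lborel)) * K"
    by (rule nn_integral_multc) simp
  also have "\<dots> < \<infinity>"
    using insert \<open>K < \<infinity>\<close> insert.IH[of "a - 1"] by (simp add: ennreal_mult_less_top)
  finally show ?case .
qed

lemma nn_integral_gram_det:
  fixes a :: real
  assumes "a > real CARD('r) + real CARD('m) - 1"
  shows "(\<integral>\<^sup>+x. ennreal (gram_det x powr (- a / 2)) \<partial>(lborel :: (real ^ 'm ^ 'r) measure)) < \<infinity>"
  using nn_integral_PiM_det_one_add_sum_outer[of "UNIV :: 'r set" a, where 'm = 'm] assms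
  by (subst nn_integral_lborel_vec) (simp_all add: gram_det_eq)

subsection \<open>Averages over the Stiefel manifold\<close>

lemma norm_square_trace: "(norm A)\<^sup>2 = trace (A ** transpose A)" for A :: "real ^ 'n ^ 'm"
  by (simp add: norm_vec_def[of A] L2_set_def sum_nonneg trace_def matrix_matrix_mult_def transpose_def
      power2_norm_eq_inner inner_vec_def)

lemma norm_transpose: "norm (transpose A) = norm A" for A :: "real ^ 'n ^ 'm"
proof -
  have "(norm (transpose A))\<^sup>2 = (norm A)\<^sup>2"
    unfolding norm_square_trace transpose_transpose by (rule trace_mul_sym)
  then show ?thesis
    by simp
qed

lemma norm_orthogonal_matrix_mult:
  fixes A :: "real ^ 'n ^ 'm"
  assumes "orthogonal_matrix g"
  shows "norm (g ** A) = norm A"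
proof -
  have "(norm (g ** A))\<^sup>2 = trace (g ** (A ** transpose A) ** transpose g)"
    by (simp add: norm_square_trace matrix_transpose_mul matrix_mul_assoc)
  also have "\<dots> = trace (transpose g ** (g ** (A ** transpose A)))"
    by (rule trace_mul_sym)
  also have "\<dots> = trace (transpose g ** g ** (A ** transpose A))"
    by (simp add: matrix_mul_assoc)
  also have "\<dots> = (norm A)\<^sup>2"
    using assms by (simp add: orthogonal_matrix norm_square_trace)
  finally show ?thesis
    by simp
qed

text \<open>Cauchy-Schwarz for each entry of the product, summed over all entries.\<close>

lemma norm_matrix_mult_le: "norm (W ** A) \<le> norm W * norm A" for A :: "real ^ 'n ^ 'm"
proof -
  have "(norm (W ** A))\<^sup>2 = (\<Sum>i\<in>UNIV. \<Sum>j\<in>UNIV. (W $ i \<bullet> transpose A $ j)\<^sup>2)"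
    by (simp add: norm_vec_def L2_set_def sum_nonneg matrix_matrix_mult_def transpose_def inner_vec_def)
  also have "\<dots> \<le> (\<Sum>i\<in>UNIV. \<Sum>j\<in>UNIV. (norm (W $ i))\<^sup>2 * (norm (transpose A $ j))\<^sup>2)"
    using Cauchy_Schwarz_ineq by (intro sum_mono) (simp add: power2_norm_eq_inner)
  also have "\<dots> = (norm W)\<^sup>2 * (norm (transpose A))\<^sup>2"
    by (simp add: norm_vec_def[of W] norm_vec_def[of "transpose A"] L2_set_def sum_nonneg sum_product)
  finally have "(norm (W ** A))\<^sup>2 \<le> (norm W * norm A)\<^sup>2"
    by (simp add: norm_transpose power_mult_distrib)
  then show ?thesis
    by (rule power2_le_imp_le) simp
qed

text \<open>
  The singular values of \<open>WB\<close> are dominated by those of \<open>B\<close>, so up to a rotation \<open>WB(WB)'\<close> lies below \<open>BB'\<close>.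
\<close>

lemma exists_orthogonal_norm_mult_contraction:
  fixes W B :: "real ^ 'n ^ 'n"
  assumes "norm W \<le> 1"
  obtains u where "orthogonal_matrix u"
    "\<And>\<xi> :: real ^ 'l ^ 'n. norm (transpose \<xi> ** (W ** B)) \<le> norm (transpose \<xi> ** (u ** B))"
proof -
  obtain v where v: "orthogonal_matrix v" "transpose (W ** B) = v ** (W ** B) ** v"
    by (rule exists_orthogonal_symmetrizer)
  obtain p where p: "orthogonal_matrix p" "transpose B = p ** B ** p"
    by (rule exists_orthogonal_symmetrizer)
  have pp: "transpose p ** p = mat 1" "p ** transpose p = mat 1"
    using p by (auto simp: orthogonal_matrix_def)
  show thesis
  proof (rule that)
    show "orthogonal_matrix (transpose v ** p)"
      using v p by (intro orthogonal_matrix_mul) simp_all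
    fix \<xi> :: "real ^ 'l ^ 'n"
    have "norm (transpose \<xi> ** (W ** B)) = norm (transpose (W ** B) ** \<xi>)"
      by (metis matrix_transpose_mul norm_transpose transpose_transpose)
    also have "\<dots> = norm (W ** (B ** (v ** \<xi>)))"
      by (simp add: v norm_orthogonal_matrix_mult flip: matrix_mul_assoc)
    also have "\<dots> \<le> norm W * norm (B ** (v ** \<xi>))"
      by (rule norm_matrix_mult_le)
    also have "\<dots> \<le> norm (B ** (v ** \<xi>))"
      using assms by (simp add: mult_left_le_one_le)
    also have "\<dots> = norm (p ** (B ** (p ** transpose p) ** (v ** \<xi>)))"
      by (simp add: norm_orthogonal_matrix_mult p pp)
    also have "\<dots> = norm ((p ** B ** p) ** (transpose p ** v ** \<xi>))"
      by (simp add: matrix_mul_assoc)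
    also have "\<dots> = norm (transpose (transpose B ** (transpose p ** v ** \<xi>)))"
      by (simp only: p(2)[symmetric] norm_transpose)
    also have "transpose (transpose B ** (transpose p ** v ** \<xi>)) = transpose \<xi> ** (transpose v ** p ** B)"
      by (simp add: matrix_transpose_mul matrix_mul_assoc)
    finally show "norm (transpose \<xi> ** (W ** B)) \<le> norm (transpose \<xi> ** (transpose v ** p ** B))" .
  qed
qed

section \<open>Gaussian averages over square matrices\<close>

lemma prod_mono_ennreal:
  fixes f g :: "'i \<Rightarrow> ennreal"
  assumes "\<And>i. i \<in> I \<Longrightarrow> f i \<le> g i"
  shows "prod f I \<le> prod g I"
  using assms by (induction I rule: infinite_finite_induct) (auto intro: mult_mono)

text \<open>The base frame selects the last \<open>l\<close> rows of \<open>WB\<close>, so the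
  integrand is a product over the rows of \<open>W\<close>. The first \<open>k\<close> rows
  contribute \<open>c\<close> each. In the others the factor \<open>exp (- (norm w)\<^sup>2)\<close>
  is bounded by 1, and substituting the transpose of \<open>B\<close> leaves at most
  \<open>c / \<bar>det B\<bar>\<close>.\<close>

lemma nn_integral_exp_frame_base:
  fixes B :: "real ^ ('k + 'l) ^ ('k::finite + 'l::finite)"
  defines "c \<equiv> (\<integral>\<^sup>+w. ennreal (exp (- (norm w)\<^sup>2)) \<partial>(lborel :: (real ^ ('k + 'l)) measure))"
  assumes "det B \<noteq> 0"
  shows "ennreal (\<bar>det B\<bar> ^ CARD('l)) * (\<integral>\<^sup>+W. ennreal (exp (- (norm W)\<^sup>2)) *
      ennreal (exp (- (norm (transpose (stiefel_base :: real ^ 'l ^ ('k + 'l)) ** (W ** B)))\<^sup>2)) \<partial>lborel)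
    \<le> c ^ CARD('k + 'l)"
proof -
  define q where "q i w = ennreal (exp (- (norm w)\<^sup>2)) *
    ennreal (case i of Inl a \<Rightarrow> 1 | Inr b \<Rightarrow> exp (- (norm (transpose B *v w))\<^sup>2))"
    for i :: "'k + 'l" and w
  have q[measurable]: "q i \<in> borel_measurable borel" for i
    unfolding q_def by (cases i) (simp_all only: sum.case, measurable)
  have base: "transpose (stiefel_base :: real ^ 'l ^ ('k + 'l)) ** (W ** B) = (\<chi> b. transpose B *v (W $ Inr b))" for W
  proof -
    have 1: "transpose (stiefel_base :: real ^ 'l ^ ('k + 'l)) ** V = (\<chi> b. V $ Inr b)"
      for V :: "real ^ ('k + 'l) ^ ('k + 'l)"
      by (simp add: vec_eq_iff matrix_matrix_mult_def stiefel_base_def stack_def transpose_def sum.Plus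
          mat_def if_distrib[of "\<lambda>x. x * _"] cong: if_cong flip: UNIV_Plus_UNIV)
    have 2: "(W ** B) $ i = transpose B *v (W $ i)" for i
      by (simp only: vec_eq_iff matrix_matrix_mult_def matrix_vector_mult_def transpose_def vec_lambda_beta
          mult.commute simp_thms)
    show ?thesis
      unfolding 1 2 ..
  qed
  have "ennreal (exp (- (norm W)\<^sup>2)) *
      ennreal (exp (- (norm (transpose (stiefel_base :: real ^ 'l ^ ('k + 'l)) ** (W ** B)))\<^sup>2))
      = (\<Prod>i\<in>UNIV. q i (W $ i))" for W
  proof -
    have "exp (- (norm W)\<^sup>2) = (\<Prod>i\<in>UNIV. exp (- (norm (W $ i))\<^sup>2))"
      by (simp add: norm_vec_def[of W] L2_set_def sum_nonneg exp_sum flip: sum_negf)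
    moreover have "exp (- (norm (\<chi> b. transpose B *v (W $ Inr b)))\<^sup>2)
        = (\<Prod>b\<in>(UNIV :: 'l set). exp (- (norm (transpose B *v (W $ Inr b)))\<^sup>2))"
      by (subst norm_vec_def) (simp add: L2_set_def sum_nonneg exp_sum flip: sum_negf)
    moreover have "\<dots> = (\<Prod>i\<in>UNIV. case i of Inl a \<Rightarrow> 1 | Inr b \<Rightarrow> exp (- (norm (transpose B *v (W $ i)))\<^sup>2))"
      by (simp add: prod.Plus flip: UNIV_Plus_UNIV)
    ultimately show ?thesis
      by (simp add: base q_def prod.distrib prod_ennreal split: sum.split)
  qed
  then have "(\<integral>\<^sup>+W. ennreal (exp (- (norm W)\<^sup>2)) *
      ennreal (exp (- (norm (transpose (stiefel_base :: real ^ 'l ^ ('k + 'l)) ** (W ** B)))\<^sup>2)) \<partial>lborel)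
    = (\<integral>\<^sup>+W. (\<Prod>i\<in>UNIV. q i (W $ i)) \<partial>(lborel :: (real ^ ('k + 'l) ^ ('k + 'l)) measure))"
    by simp
  also have "\<dots> = (\<Prod>i\<in>UNIV. \<integral>\<^sup>+w. q i w \<partial>lborel)"
    by (rule nn_integral_lborel_vec_prod) simp
  also have "\<dots> = c ^ CARD('k) * (\<Prod>b\<in>(UNIV :: 'l set). \<integral>\<^sup>+w. q (Inr b) w \<partial>lborel)"
    by (simp add: prod.Plus q_def c_def flip: UNIV_Plus_UNIV)
  finally have eq: "(\<integral>\<^sup>+W. ennreal (exp (- (norm W)\<^sup>2)) *
      ennreal (exp (- (norm (transpose (stiefel_base :: real ^ 'l ^ ('k + 'l)) ** (W ** B)))\<^sup>2)) \<partial>lborel)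
    = c ^ CARD('k) * (\<Prod>b\<in>(UNIV :: 'l set). \<integral>\<^sup>+w. q (Inr b) w \<partial>lborel)" .
  have "ennreal \<bar>det B\<bar> * (\<integral>\<^sup>+w. q (Inr b) w \<partial>lborel) \<le> c" for b
  proof -
    have "q (Inr b) w \<le> ennreal (exp (- (norm (transpose B *v w))\<^sup>2))" for w
      unfolding q_def by (simp add: mult_left_le_one_le flip: ennreal_mult)
    then have "ennreal \<bar>det B\<bar> * (\<integral>\<^sup>+w. q (Inr b) w \<partial>lborel)
        \<le> ennreal \<bar>det B\<bar> * (\<integral>\<^sup>+w. ennreal (exp (- (norm (transpose B *v w))\<^sup>2)) \<partial>lborel)"
      by (intro mult_left_mono nn_integral_mono) simp_all
    also have "\<dots> = c"
      unfolding c_def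
      using nn_integral_lborel_matrix_vector_mult[of "transpose B" "\<lambda>w. ennreal (exp (- (norm w)\<^sup>2))"] assms
      by simp
    finally show ?thesis .
  qed
  then have "(\<Prod>b\<in>(UNIV :: 'l set). ennreal \<bar>det B\<bar> * (\<integral>\<^sup>+w. q (Inr b) w \<partial>lborel)) \<le> (\<Prod>b\<in>(UNIV :: 'l set). c)"
    by (rule prod_mono_ennreal)
  then have "ennreal \<bar>det B\<bar> ^ CARD('l) * (\<Prod>b\<in>(UNIV :: 'l set). \<integral>\<^sup>+w. q (Inr b) w \<partial>lborel) \<le> c ^ CARD('l)"
    by (simp add: prod.distrib)
  then have "c ^ CARD('k) * (ennreal \<bar>det B\<bar> ^ CARD('l) * (\<Prod>b\<in>(UNIV :: 'l set). \<integral>\<^sup>+w. q (Inr b) w \<partial>lborel))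
      \<le> c ^ CARD('k) * c ^ CARD('l)"
    by (rule mult_left_mono) simp
  then show ?thesis
    unfolding eq by (simp add: power_add ennreal_power mult.left_commute)
qed

text \<open>Substituting \<open>gW\<close> for \<open>W\<close>, with \<open>g\<close> the rotation
  from the base frame to \<xi>, preserves both Lebesgue measure and the Gaussian and turns \<xi>
  into the base frame.\<close>

lemma nn_integral_exp_frame:
  fixes B :: "real ^ ('k + 'l) ^ ('k::finite + 'l::finite)" and \<xi> :: "real ^ 'l ^ ('k + 'l)"
  assumes "\<xi> \<in> stiefel"
  shows "(\<integral>\<^sup>+W. ennreal (exp (- (norm W)\<^sup>2)) * ennreal (exp (- (norm (transpose \<xi> ** (W ** B)))\<^sup>2)) \<partial>lborel)
    = (\<integral>\<^sup>+W. ennreal (exp (- (norm W)\<^sup>2)) *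
      ennreal (exp (- (norm (transpose (stiefel_base :: real ^ 'l ^ ('k + 'l)) ** (W ** B)))\<^sup>2)) \<partial>lborel)"
proof -
  define g where "g = frame_rotation \<xi>"
  have g: "orthogonal_matrix g" and \<xi>: "\<xi> = g ** stiefel_base"
    using frame_rotation[OF assms] by (simp_all add: g_def)
  have gg: "transpose g ** g = mat 1"
    using g by (simp add: orthogonal_matrix)
  have "\<bar>det g\<bar> = 1"
    using det_orthogonal_matrix[OF g] by auto
  then have "(\<integral>\<^sup>+W. ennreal (exp (- (norm W)\<^sup>2)) * ennreal (exp (- (norm (transpose \<xi> ** (W ** B)))\<^sup>2)) \<partial>lborel)
    = (\<integral>\<^sup>+W. ennreal (exp (- (norm (g ** W))\<^sup>2)) * ennreal (exp (- (norm (transpose \<xi> ** (g ** W ** B)))\<^sup>2)) \<partial>lborel)"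
    by (subst nn_integral_lborel_matrix_mult[of g]) auto
  moreover have "transpose \<xi> ** (g ** W ** B) = transpose stiefel_base ** (W ** B)" for W :: "real ^ ('k + 'l) ^ ('k + 'l)"
  proof -
    have "transpose \<xi> ** (g ** W ** B) = transpose stiefel_base ** ((transpose g ** g) ** W ** B)"
      by (simp add: \<xi> matrix_transpose_mul matrix_mul_assoc)
    then show ?thesis
      by (simp add: gg matrix_mul_assoc)
  qed
  ultimately show ?thesis
    by (simp add: norm_orthogonal_matrix_mult g)
qed

section \<open>Averages with respect to an invariant measure\<close>

lemma
  assumes "stiefel_invariant_measure \<sigma>"
  shows space_stiefel_invariant_measure: "space \<sigma> = stiefel"
    and borel_measurable_stiefel_invariant_measure:
      "f \<in> borel_measurable borel \<Longrightarrow> f \<in> borel_measurable \<sigma>"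
proof -
  have sets: "sets \<sigma> = sets (restrict_space borel stiefel)"
    using assms by (simp add: stiefel_invariant_measure_def)
  show "space \<sigma> = stiefel"
    using sets_eq_imp_space_eq[OF sets] by (simp add: space_restrict_space)
  show "f \<in> borel_measurable \<sigma>" if "f \<in> borel_measurable borel"
    using that measurable_restrict_space1 measurable_cong_sets[OF sets refl] by blast
qed

lemma nn_integral_stiefel_rotate:
  fixes \<sigma> :: "(real ^ 'l ^ 'n) measure"
  assumes \<sigma>: "stiefel_invariant_measure \<sigma>" and u: "orthogonal_matrix u" and f: "f \<in> borel_measurable borel"
  shows "(\<integral>\<^sup>+\<xi>. f (u ** \<xi>) \<partial>\<sigma>) = (\<integral>\<^sup>+\<xi>. f \<xi> \<partial>\<sigma>)"
proof -
  have sets: "sets \<sigma> = sets (restrict_space borel stiefel)"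
    using \<sigma> by (simp add: stiefel_invariant_measure_def)
  have "u ** \<xi> \<in> stiefel" if "\<xi> \<in> stiefel" for \<xi> :: "real ^ 'l ^ 'n"
  proof -
    have "transpose (u ** \<xi>) ** (u ** \<xi>) = transpose \<xi> ** (transpose u ** u) ** \<xi>"
      by (simp add: matrix_transpose_mul matrix_mul_assoc)
    then show ?thesis
      using that u by (simp add: stiefel_def orthogonal_matrix)
  qed
  then have "(\<lambda>\<xi>. u ** \<xi>) \<in> \<sigma> \<rightarrow>\<^sub>M restrict_space borel stiefel"
    using space_stiefel_invariant_measure[OF \<sigma>]
    by (intro measurable_restrict_space2 borel_measurable_stiefel_invariant_measure[OF \<sigma>]) auto
  then have "(\<lambda>\<xi>. u ** \<xi>) \<in> \<sigma> \<rightarrow>\<^sub>M \<sigma>"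
    using measurable_cong_sets[OF refl sets] by blast
  then have "(\<integral>\<^sup>+\<xi>. f \<xi> \<partial>distr \<sigma> \<sigma> (\<lambda>\<xi>. u ** \<xi>)) = (\<integral>\<^sup>+\<xi>. f (u ** \<xi>) \<partial>\<sigma>)"
    by (rule nn_integral_distr) (simp add: borel_measurable_stiefel_invariant_measure[OF \<sigma> f])
  then show ?thesis
    using \<sigma> u by (simp add: stiefel_invariant_measure_def)
qed

text \<open>The function \<open>\<Phi>\<close> of the introduction. The number of columns is left
  free, so that it applies both to \<open>x\<close> and to the square factor
  \<open>B\<close>.\<close>

definition frame_average :: "(real ^ 'l ^ 'n) measure \<Rightarrow> real ^ 'm ^ 'n \<Rightarrow> ennreal" where
  "frame_average \<sigma> x = (\<integral>\<^sup>+\<xi>. ennreal (exp (- (norm (transpose \<xi> ** x))\<^sup>2)) \<partial>\<sigma>)"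

text \<open>Invariance of \<sigma> allows rotating \<open>B\<close> by the \<open>u\<close> for
  which the comparison of norms holds for every \<xi>; then the integrands compare
  pointwise.\<close>

lemma frame_average_contraction:
  fixes \<sigma> :: "(real ^ 'l ^ 'n) measure" and B :: "real ^ 'n ^ 'n"
  assumes \<sigma>: "stiefel_invariant_measure \<sigma>" and "norm W \<le> 1"
  shows "frame_average \<sigma> B \<le> frame_average \<sigma> (W ** B)"
proof -
  obtain u where u: "orthogonal_matrix u"
    and le: "\<And>\<xi> :: real ^ 'l ^ 'n. norm (transpose \<xi> ** (W ** B)) \<le> norm (transpose \<xi> ** (u ** B))"
    using exists_orthogonal_norm_mult_contraction[OF assms(2)] by metis
  have "frame_average \<sigma> B = (\<integral>\<^sup>+\<xi>. ennreal (exp (- (norm (transpose (transpose u ** \<xi>) ** B))\<^sup>2)) \<partial>\<sigma>)"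
    unfolding frame_average_def
    by (rule nn_integral_stiefel_rotate[OF \<sigma>, symmetric]) (use u in simp_all)
  also have "\<dots> = (\<integral>\<^sup>+\<xi>. ennreal (exp (- (norm (transpose \<xi> ** (u ** B)))\<^sup>2)) \<partial>\<sigma>)"
    by (simp add: matrix_transpose_mul matrix_mul_assoc)
  also have "\<dots> \<le> frame_average \<sigma> (W ** B)"
    unfolding frame_average_def
    by (intro nn_integral_mono ennreal_leI) (simp add: le power_mono)
  finally show ?thesis .
qed

text \<open>For an orthonormal frame, taking the trace of \<open>\<xi>'(I + xx')\<xi>\<close> gives
  \<open>(norm (transpose \<xi> ** B))\<^sup>2 = l + (norm (transpose \<xi> **
  x))\<^sup>2\<close>.\<close>

lemma frame_average_factor:
  fixes \<sigma> :: "(real ^ 'l ^ 'n) measure" and x :: "real ^ 'm ^ 'n" and B :: "real ^ 'n ^ 'n"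
  assumes \<sigma>: "stiefel_invariant_measure \<sigma>" and B: "mat 1 + x ** transpose x = B ** transpose B"
  shows "frame_average \<sigma> x = ennreal (exp (real CARD('l))) * frame_average \<sigma> B"
proof -
  have "(norm (transpose \<xi> ** B))\<^sup>2 = real CARD('l) + (norm (transpose \<xi> ** x))\<^sup>2"
    if "\<xi> \<in> space \<sigma>" for \<xi> :: "real ^ 'l ^ 'n"
  proof -
    have \<xi>: "transpose \<xi> ** \<xi> = mat 1"
      using that \<sigma> by (simp add: space_stiefel_invariant_measure stiefel_def)
    have "(transpose \<xi> ** B) ** transpose (transpose \<xi> ** B) = transpose \<xi> ** (B ** transpose B) ** \<xi>"
      by (simp add: matrix_transpose_mul matrix_mul_assoc)
    also have "\<dots> = mat 1 + (transpose \<xi> ** x) ** transpose (transpose \<xi> ** x)"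
      by (simp add: \<xi> matrix_add_ldistrib matrix_add_rdistrib matrix_transpose_mul matrix_mul_assoc flip: B)
    finally show ?thesis
      by (simp add: norm_square_trace trace_add trace_I)
  qed
  then have "frame_average \<sigma> B
      = (\<integral>\<^sup>+\<xi>. ennreal (exp (- real CARD('l))) * ennreal (exp (- (norm (transpose \<xi> ** x))\<^sup>2)) \<partial>\<sigma>)"
    unfolding frame_average_def
    by (intro nn_integral_cong) (simp flip: ennreal_mult exp_add)
  also have "\<dots> = ennreal (exp (- real CARD('l))) * frame_average \<sigma> x"
    unfolding frame_average_def
    by (intro nn_integral_cmult borel_measurable_stiefel_invariant_measure[OF \<sigma>]) simp
  finally show ?thesis
    by (simp add: mult.assoc[symmetric] exp_minus flip: ennreal_mult)
qed

text \<open>The second main estimate. A lower bound for the Gaussian average of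
  \<open>frame_average \<sigma> (W ** B)\<close> comes from contractions, an upper bound from
  exchanging the integrals; together they bound \<open>frame_average \<sigma> B\<close>.\<close>

lemma frame_average_le_gram_det:
  fixes \<sigma> :: "(real ^ 'l ^ ('k::finite + 'l::finite)) measure"
  assumes \<sigma>: "stiefel_invariant_measure \<sigma>"
  obtains C :: ennreal where "C < \<infinity>"
    "\<And>x :: real ^ 'm ^ ('k + 'l). frame_average \<sigma> x \<le> C * ennreal (gram_det x powr (- real CARD('l) / 2))"
proof -
  interpret finite_measure \<sigma>
    using \<sigma> by (simp add: stiefel_invariant_measure_def)
  interpret pair_sigma_finite "lborel :: (real ^ ('k + 'l) ^ ('k + 'l)) measure" \<sigma> ..
  define c where "c = (\<integral>\<^sup>+w. ennreal (exp (- (norm w)\<^sup>2)) \<partial>(lborel :: (real ^ ('k + 'l)) measure))"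
  \<comment> \<open>A lower bound for the Gaussian mass of the unit ball: there the density is at
    least \<open>exp (- 1)\<close>.\<close>
  define c1 where "c1 = (\<integral>\<^sup>+W. ennreal (exp (- 1)) * indicator (cball 0 1) W \<partial>(lborel :: (real ^ ('k + 'l) ^ ('k + 'l)) measure))"
  have c1: "c1 = ennreal (exp (- 1)) * emeasure lborel (cball 0 1 :: (real ^ ('k + 'l) ^ ('k + 'l)) set)"
    unfolding c1_def by (rule nn_integral_cmult_indicator) simp
  have "c1 \<noteq> 0"
  proof -
    have "emeasure lborel (cball 0 1 :: (real ^ ('k + 'l) ^ ('k + 'l)) set) \<noteq> 0"
      using emeasure_lborel_cball_finite content_cball_pos[of 1 "0 :: real ^ ('k + 'l) ^ ('k + 'l)"]
      by (auto simp: measure_def)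
    then show ?thesis
      by (simp add: c1)
  qed
  have "c1 < \<infinity>"
    unfolding c1 using emeasure_bounded_finite[of "cball 0 1 :: (real ^ ('k + 'l) ^ ('k + 'l)) set"]
    by (simp add: ennreal_mult_less_top)
  have [measurable]: "fst \<in> borel_measurable (\<sigma> \<Otimes>\<^sub>M (lborel :: (real ^ ('k + 'l) ^ ('k + 'l)) measure))"
    "snd \<in> borel_measurable ((lborel :: (real ^ ('k + 'l) ^ ('k + 'l)) measure) \<Otimes>\<^sub>M \<sigma>)"
    by (rule measurable_compose[OF measurable_fst borel_measurable_stiefel_invariant_measure[OF \<sigma>]]
        measurable_compose[OF measurable_snd borel_measurable_stiefel_invariant_measure[OF \<sigma>]]; simp)+
  define K where "K = emeasure \<sigma> (space \<sigma>) * c ^ CARD('k + 'l)"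
  have "c < \<infinity>"
    unfolding c_def by (rule nn_integral_exp_minus_norm_square)
  then have "c ^ CARD('k + 'l) < \<infinity>"
    unfolding infinity_ennreal_def power_less_top_ennreal by blast
  moreover have "emeasure \<sigma> (space \<sigma>) < \<infinity>"
    by (metis emeasure_finite infinity_ennreal_def less_top)
  ultimately have "K < \<infinity>"
    unfolding K_def infinity_ennreal_def ennreal_mult_less_top by blast
  have *: "c1 * (ennreal (\<bar>det B\<bar> ^ CARD('l)) * frame_average \<sigma> B) \<le> K" if "det B \<noteq> 0" for B :: "real ^ ('k + 'l) ^ ('k + 'l)"
  proof -
    define e where "e W \<xi> = ennreal (exp (- (norm W)\<^sup>2)) * ennreal (exp (- (norm (transpose \<xi> ** (W ** B)))\<^sup>2))"
      for W :: "real ^ ('k + 'l) ^ ('k + 'l)" and \<xi> :: "real ^ 'l ^ ('k + 'l)"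
    have e_meas: "(\<lambda>(W, \<xi>). e W \<xi>) \<in> borel_measurable (lborel \<Otimes>\<^sub>M \<sigma>)"
      unfolding e_def split_beta' by measurable
    have "c1 * frame_average \<sigma> B
        = (\<integral>\<^sup>+W. ennreal (exp (- 1)) * indicator (cball 0 1) W * frame_average \<sigma> B
          \<partial>(lborel :: (real ^ ('k + 'l) ^ ('k + 'l)) measure))"
      unfolding c1_def
      by (rule nn_integral_multc[symmetric]) (intro borel_measurable_times_ennreal borel_measurable_const borel_measurable_indicator; simp)
    \<comment> \<open>Only \<open>W\<close> in the unit ball is kept; these are contractions, to
      which \<open>frame_average_contraction\<close> applies.\<close>
    also have "\<dots> \<le> (\<integral>\<^sup>+W. \<integral>\<^sup>+\<xi>. e W \<xi> \<partial>\<sigma> \<partial>lborel)"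
    proof (rule nn_integral_mono)
      fix W :: "real ^ ('k + 'l) ^ ('k + 'l)"
      have "(\<integral>\<^sup>+\<xi>. e W \<xi> \<partial>\<sigma>) = ennreal (exp (- (norm W)\<^sup>2)) * frame_average \<sigma> (W ** B)"
        unfolding e_def frame_average_def
        by (intro nn_integral_cmult borel_measurable_stiefel_invariant_measure[OF \<sigma>]) simp
      moreover have "ennreal (exp (- 1)) * frame_average \<sigma> B
          \<le> ennreal (exp (- (norm W)\<^sup>2)) * frame_average \<sigma> (W ** B)" if "norm W \<le> 1"
        using that frame_average_contraction[OF \<sigma> that]
        by (intro mult_mono ennreal_leI) (simp_all add: power_le_one)
      ultimately show "ennreal (exp (- 1)) * indicator (cball 0 1) W * frame_average \<sigma> B \<le> (\<integral>\<^sup>+\<xi>. e W \<xi> \<partial>\<sigma>)"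
        by (auto simp: indicator_def)
    qed
    also have "\<dots> = (\<integral>\<^sup>+\<xi>. \<integral>\<^sup>+W. e W \<xi> \<partial>lborel \<partial>\<sigma>)"
      by (rule Fubini'[symmetric]) (rule e_meas)
    \<comment> \<open>After the exchange the inner integral is the same for all frames, so
      integrating over \<sigma> multiplies it by the total mass.\<close>
    also have "\<dots> = (\<integral>\<^sup>+\<xi>. (\<integral>\<^sup>+W. e W stiefel_base \<partial>lborel) \<partial>\<sigma>)"
      unfolding e_def using nn_integral_exp_frame
      by - (rule nn_integral_cong, simp add: space_stiefel_invariant_measure[OF \<sigma>])
    finally have "c1 * frame_average \<sigma> B \<le> (\<integral>\<^sup>+W. e W stiefel_base \<partial>lborel) * emeasure \<sigma> (space \<sigma>)"
      by simp
    then have "ennreal (\<bar>det B\<bar> ^ CARD('l)) * (c1 * frame_average \<sigma> B)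
        \<le> ennreal (\<bar>det B\<bar> ^ CARD('l)) * ((\<integral>\<^sup>+W. e W stiefel_base \<partial>lborel) * emeasure \<sigma> (space \<sigma>))"
      by (rule mult_left_mono) simp
    also have "\<dots> = (ennreal (\<bar>det B\<bar> ^ CARD('l)) * (\<integral>\<^sup>+W. e W stiefel_base \<partial>lborel)) * emeasure \<sigma> (space \<sigma>)"
      by (simp add: mult.assoc)
    also have "\<dots> \<le> c ^ CARD('k + 'l) * emeasure \<sigma> (space \<sigma>)"
      unfolding c_def e_def by (rule mult_right_mono[OF nn_integral_exp_frame_base[OF that]]) simp
    finally show ?thesis
      by (simp add: K_def mult_ac)
  qed
  define C where "C = ennreal (exp (real CARD('l))) * (K / c1)"
  have "K / c1 < \<infinity>"
    using \<open>K < \<infinity>\<close> \<open>c1 \<noteq> 0\<close> by (auto simp: ennreal_divide_eq_top_iff simp flip: less_top)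
  then have "C < \<infinity>"
    unfolding C_def infinity_ennreal_def ennreal_mult_less_top by simp
  moreover have "frame_average \<sigma> x \<le> C * ennreal (gram_det x powr (- real CARD('l) / 2))" for x :: "real ^ 'm ^ ('k + 'l)"
  proof -
    have "(\<Sum>j\<in>UNIV. outer (transpose x $ j)) = x ** transpose x"
      using sum_outer_rows[of "transpose x"] by simp
    then obtain B :: "real ^ ('k + 'l) ^ ('k + 'l)"
      where B: "mat 1 + x ** transpose x = B ** transpose B" "det B \<noteq> 0"
      using one_add_sum_outer_factor[of "UNIV :: 'm set" "($) (transpose x)"] by (metis finite_UNIV finite)
    \<comment> \<open>Sylvester's identity passes from \<open>x'x\<close> to \<open>xx'\<close>,
      which is what \<open>B\<close> factors.\<close>
    have "gram_det x = \<bar>det B\<bar>\<^sup>2"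
      by (simp add: gram_det_def Sylvester_determinant B(1) det_mul power2_eq_square)
    then have "gram_det x powr (real CARD('l) / 2) = (\<bar>det B\<bar> powr 2) powr (real CARD('l) / 2)"
      using B(2) by (simp add: powr_numeral)
    also have "\<dots> = \<bar>det B\<bar> powr real CARD('l)"
      unfolding powr_powr by simp
    finally have "gram_det x powr (real CARD('l) / 2) = \<bar>det B\<bar> powr real CARD('l)" .
    then have det: "\<bar>det B\<bar> ^ CARD('l) = gram_det x powr (real CARD('l) / 2)"
      using B(2) by (simp add: powr_realpow)
    have "ennreal (gram_det x powr (real CARD('l) / 2)) * frame_average \<sigma> B \<le> K / c1"
      using divide_right_mono_ennreal[OF *[OF B(2)], of c1] \<open>c1 \<noteq> 0\<close> \<open>c1 < \<infinity>\<close>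
      by (simp add: det mult.commute[of c1] mult_divide_eq_ennreal)
    then have "ennreal (gram_det x powr (- real CARD('l) / 2)) *
        (ennreal (gram_det x powr (real CARD('l) / 2)) * frame_average \<sigma> B)
      \<le> ennreal (gram_det x powr (- real CARD('l) / 2)) * (K / c1)"
      by (rule mult_left_mono) simp
    moreover have "gram_det x powr (- real CARD('l) / 2) * gram_det x powr (real CARD('l) / 2) = 1"
      using gram_det_ge_1[of x] by (simp flip: powr_add)
    ultimately have "frame_average \<sigma> B \<le> ennreal (gram_det x powr (- real CARD('l) / 2)) * (K / c1)"
      by (simp add: mult.assoc[symmetric] flip: ennreal_mult)
    then have "frame_average \<sigma> x \<le> ennreal (exp (real CARD('l))) *
        (ennreal (gram_det x powr (- real CARD('l) / 2)) * (K / c1))"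
      unfolding frame_average_factor[OF \<sigma> B(1)] by (rule mult_left_mono) simp
    then show ?thesis
      by (simp add: C_def mult_ac)
  qed
  ultimately show thesis
    using that by blast
qed

subsection \<open>Integrals over matrix planes\<close>

text \<open>Separates the direction of a plane from its base point, so that a rotation can be
  applied to each part.\<close>

lemma stack_eq_matrix_mult:
  "stack \<omega> t = stack (mat 1) 0 ** \<omega> + stiefel_base ** t"
  for \<omega> :: "real ^ 'm ^ 'k::finite" and t :: "real ^ 'm ^ 'l::finite"
proof -
  have "stack \<omega> t $ i $ j = (stack (mat 1) 0 ** \<omega> + stiefel_base ** t) $ i $ j" for i j
    by (cases i) (simp_all add: stack_def stiefel_base_def matrix_matrix_mult_def mat_def
        if_distrib[of "\<lambda>x. x * _"] cong: if_cong)
  then show ?thesis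
    by (simp add: vec_eq_iff)
qed

lemma coordinate_projections:
  defines "P \<equiv> stack (mat 1 :: real ^ 'k ^ 'k::finite) (0 :: real ^ 'k ^ 'l::finite)"
  shows "P ** transpose P + stiefel_base ** transpose stiefel_base = mat 1"
    and "transpose P ** P = mat 1"
    and "transpose stiefel_base ** stack \<omega> (t :: real ^ 'm ^ 'l) = t"
proof -
  have "(P ** transpose P + stiefel_base ** transpose stiefel_base) $ i $ j
      = (mat 1 :: real ^ ('k + 'l) ^ ('k + 'l)) $ i $ j" for i j
    by (cases i; cases j) (simp_all add: P_def stack_def stiefel_base_def matrix_matrix_mult_def mat_def
        transpose_def if_distrib[of "\<lambda>x. x * _"] cong: if_cong)
  then show "P ** transpose P + stiefel_base ** transpose stiefel_base = mat 1"
    by (simp only: vec_eq_iff simp_thms)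
  show "transpose P ** P = mat 1"
    by (simp add: vec_eq_iff P_def stack_def matrix_matrix_mult_def mat_def sum.Plus
        transpose_def if_distrib[of "\<lambda>x. x * _"] cong: if_cong flip: UNIV_Plus_UNIV)
  show "transpose stiefel_base ** stack \<omega> (t :: real ^ 'm ^ 'l) = t"
    by (simp add: vec_eq_iff stiefel_base_def stack_def matrix_matrix_mult_def mat_def sum.Plus
        transpose_def if_distrib[of "\<lambda>x. x * _"] cong: if_cong flip: UNIV_Plus_UNIV)
qed

text \<open>The Radon transform for functions with values in \<open>[0, \<infinity>]\<close>, where
  it is always defined.\<close>

definition plane_integral ::
  "(real ^ 'm ^ ('k::finite + 'l::finite) \<Rightarrow> ennreal) \<Rightarrow> real ^ 'l ^ ('k + 'l) \<Rightarrow> real ^ 'm ^ 'l \<Rightarrow> ennreal" where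
  "plane_integral h \<xi> t = (\<integral>\<^sup>+\<omega>. h (frame_rotation \<xi> ** stack \<omega> t) \<partial>(lborel :: (real ^ 'm ^ 'k) measure))"

text \<open>
  \<^const>\<open>frame_rotation\<close> is an arbitrary choice and need not be measurable in \<open>\<xi>\<close>. If \<open>\<eta>\<close> consists of the first \<open>k\<close>
  columns of a rotation with last columns \<open>\<xi>\<close>, then \<open>I - \<xi>\<xi>' = \<eta>\<eta>'\<close>, so substituting \<open>\<eta>'Z\<omega>\<close> for \<open>\<omega>\<close> gives an
  expression in \<open>\<xi>\<close> and \<open>t\<close> alone, valid where the Jacobian \<open>det (\<eta>'Z)\<^sup>2 = det (Z'(I - \<xi>\<xi>')Z)\<close> does not vanish;
  countably many matrices \<open>Z\<close> suffice for all \<open>\<xi>\<close>.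
\<close>

definition plane_gram :: "real ^ 'l ^ 'n \<Rightarrow> real ^ 'k ^ 'n \<Rightarrow> real" where
  "plane_gram \<xi> Z = det (transpose Z ** (mat 1 - \<xi> ** transpose \<xi>) ** Z)"

text \<open>\<eta> consists of the first \<open>k\<close> columns of the rotation, an orthonormal
  basis of the complement of \<xi>. The projection \<open>I - \<xi>\<xi>'\<close> onto that
  complement does not depend on the rotation.\<close>

lemma stiefel_complement:
  fixes \<xi> :: "real ^ 'l ^ ('k::finite + 'l::finite)"
  assumes "\<xi> \<in> stiefel"
  defines "\<eta> \<equiv> frame_rotation \<xi> ** stack (mat 1 :: real ^ 'k ^ 'k) 0"
  shows "mat 1 - \<xi> ** transpose \<xi> = \<eta> ** transpose \<eta>" and "transpose \<eta> ** \<eta> = mat 1"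
    and "frame_rotation \<xi> ** stack \<omega> t = \<eta> ** \<omega> + \<xi> ** (t :: real ^ 'm ^ 'l)"
proof -
  let ?g = "frame_rotation \<xi>" and ?P = "stack (mat 1 :: real ^ 'k ^ 'k) (0 :: real ^ 'k ^ 'l)"
  have g: "?g ** transpose ?g = mat 1" "transpose ?g ** ?g = mat 1" and \<xi>: "?g ** stiefel_base = \<xi>"
    using frame_rotation[OF assms(1)] by (auto simp: orthogonal_matrix_def)
  have "mat 1 = ?g ** (?P ** transpose ?P + stiefel_base ** transpose stiefel_base) ** transpose ?g"
    by (simp add: coordinate_projections g)
  also have "\<dots> = \<eta> ** transpose \<eta> + (?g ** stiefel_base) ** transpose (?g ** stiefel_base)"
    by (simp add: \<eta>_def matrix_add_ldistrib matrix_add_rdistrib matrix_transpose_mul matrix_mul_assoc)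
  finally show "mat 1 - \<xi> ** transpose \<xi> = \<eta> ** transpose \<eta>"
    unfolding \<xi> by (metis add_diff_cancel_right')
  have "transpose \<eta> ** \<eta> = transpose ?P ** (transpose ?g ** ?g) ** ?P"
    by (simp add: \<eta>_def matrix_transpose_mul matrix_mul_assoc)
  then show "transpose \<eta> ** \<eta> = mat 1"
    by (simp add: g coordinate_projections)
  have "?g ** stack \<omega> t = \<eta> ** \<omega> + (?g ** stiefel_base) ** t"
    by (subst stack_eq_matrix_mult) (simp add: \<eta>_def matrix_add_ldistrib matrix_mul_assoc)
  then show "?g ** stack \<omega> t = \<eta> ** \<omega> + \<xi> ** t"
    by (simp only: \<xi>)
qed

lemma plane_integral_eq:
  fixes h :: "real ^ 'm ^ ('k::finite + 'l::finite) \<Rightarrow> ennreal" and Z :: "real ^ 'k ^ ('k + 'l)"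
  assumes \<xi>: "\<xi> \<in> stiefel" and [measurable]: "h \<in> borel_measurable borel" and Z: "plane_gram \<xi> Z \<noteq> 0"
  shows "plane_integral h \<xi> t = ennreal (sqrt (plane_gram \<xi> Z) ^ CARD('m)) *
    (\<integral>\<^sup>+\<omega>. h (\<xi> ** t + (mat 1 - \<xi> ** transpose \<xi>) ** Z ** \<omega>) \<partial>lborel)"
proof -
  define \<eta> where "\<eta> = frame_rotation \<xi> ** stack (mat 1 :: real ^ 'k ^ 'k) 0"
  note \<eta> = stiefel_complement[OF \<xi>, folded \<eta>_def]
  \<comment> \<open>\<open>S\<close> is square and is the matrix of the substitution; the Gram
    determinant of the projection of \<open>Z\<close> is \<open>(det S)\<^sup>2\<close>.\<close>
  define S where "S = transpose \<eta> ** Z"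
  have "plane_gram \<xi> Z = det (transpose S ** S)"
    by (simp add: plane_gram_def S_def \<eta>(1) matrix_transpose_mul matrix_mul_assoc)
  then have gram: "plane_gram \<xi> Z = (det S)\<^sup>2"
    by (simp add: det_mul power2_eq_square)
  with Z have "det S \<noteq> 0"
    by auto
  have "(\<lambda>\<omega>. h (frame_rotation \<xi> ** stack \<omega> t)) \<in> borel_measurable borel"
    by measurable
  from nn_integral_lborel_matrix_mult[OF \<open>det S \<noteq> 0\<close> this] show ?thesis
    by (simp add: plane_integral_def gram \<eta>(3)) (simp add: \<eta>(1) S_def matrix_mul_assoc add.commute)
qed

text \<open>Each \<open>R Z\<close> is measurable and equals the plane integral or 0, so the
  supremum over a countable dense set of \<open>Z\<close> recovers the plane integral.\<close>

lemma borel_measurable_plane_integral: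
  fixes h :: "real ^ 'm ^ ('k::finite + 'l::finite) \<Rightarrow> ennreal" and \<sigma> :: "(real ^ 'l ^ ('k + 'l)) measure"
  assumes \<sigma>: "stiefel_invariant_measure \<sigma>" and [measurable]: "h \<in> borel_measurable borel"
  shows "(\<lambda>(\<xi>, t). plane_integral h \<xi> t) \<in> borel_measurable (\<sigma> \<Otimes>\<^sub>M lborel)"
proof -
  obtain D :: "(real ^ 'k ^ ('k + 'l)) set"
    where D: "countable D" "\<And>X. open X \<Longrightarrow> X \<noteq> {} \<Longrightarrow> \<exists>d\<in>D. d \<in> X"
    using countable_dense_setE by blast
  \<comment> \<open>The default 0 makes a degenerate \<open>Z\<close> invisible to the
    supremum.\<close>
  define R where "R Z p = (if plane_gram (fst p) Z \<noteq> 0 then ennreal (sqrt (plane_gram (fst p) Z) ^ CARD('m)) *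
    (\<integral>\<^sup>+\<omega>. h (fst p ** snd p + (mat 1 - fst p ** transpose (fst p)) ** Z ** \<omega>) \<partial>lborel) else 0)"
    for Z :: "real ^ 'k ^ ('k + 'l)" and p :: "(real ^ 'l ^ ('k + 'l)) \<times> (real ^ 'm ^ 'l)"
  have [measurable]: "fst \<in> borel_measurable (\<sigma> \<Otimes>\<^sub>M (lborel :: (real ^ 'm ^ 'l) measure))"
    by (rule measurable_compose[OF measurable_fst borel_measurable_stiefel_invariant_measure[OF \<sigma>]]) simp
  have [measurable]: "(\<lambda>p. fst (fst p)) \<in> borel_measurable
      ((\<sigma> \<Otimes>\<^sub>M (lborel :: (real ^ 'm ^ 'l) measure)) \<Otimes>\<^sub>M (lborel :: (real ^ 'm ^ 'k) measure))"
    by (rule measurable_compose[OF measurable_fst]) measurable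
  have "R Z \<in> borel_measurable (\<sigma> \<Otimes>\<^sub>M lborel)" for Z
    unfolding R_def plane_gram_def by measurable
  then have "(\<lambda>p. SUP Z\<in>D. R Z p) \<in> borel_measurable (\<sigma> \<Otimes>\<^sub>M lborel)"
    using D(1) by (intro borel_measurable_SUP) auto
  moreover have "(SUP Z\<in>D. R Z p) = (case p of (\<xi>, t) \<Rightarrow> plane_integral h \<xi> t)"
    if "p \<in> space (\<sigma> \<Otimes>\<^sub>M (lborel :: (real ^ 'm ^ 'l) measure))" for p
  proof -
    obtain \<xi> t where p: "p = (\<xi>, t)"
      by (cases p)
    then have \<xi>: "\<xi> \<in> stiefel"
      using that by (auto simp: space_pair_measure space_stiefel_invariant_measure[OF \<sigma>])
    have R: "R Z p = (if plane_gram \<xi> Z \<noteq> 0 then plane_integral h \<xi> t else 0)" for Z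
      using plane_integral_eq[OF \<xi> assms(2)] by (simp add: R_def p)
    define \<eta> where "\<eta> = frame_rotation \<xi> ** stack (mat 1 :: real ^ 'k ^ 'k) 0"
    note \<eta> = stiefel_complement[OF \<xi>, folded \<eta>_def]
    have "transpose \<eta> ** (mat 1 - \<xi> ** transpose \<xi>) ** \<eta> = (transpose \<eta> ** \<eta>) ** (transpose \<eta> ** \<eta>)"
      by (simp only: \<eta>(1) matrix_mul_assoc)
    \<comment> \<open>The matrix \<eta> itself shows that the open set of nondegenerate
      \<open>Z\<close> is nonempty, so it meets \<open>D\<close>.\<close>
    then have "plane_gram \<xi> \<eta> \<noteq> 0"
      by (simp add: plane_gram_def \<eta>(2))
    moreover have "open {Z :: real ^ 'k ^ ('k + 'l). plane_gram \<xi> Z \<noteq> 0}"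
      unfolding plane_gram_def det_def matrix_matrix_mult_def transpose_def
      by (intro open_Collect_neq continuous_intros)
    ultimately obtain Z where "Z \<in> D" "plane_gram \<xi> Z \<noteq> 0"
      using D(2)[of "{Z. plane_gram \<xi> Z \<noteq> 0}"] by blast
    then have "(SUP Z\<in>D. R Z p) = plane_integral h \<xi> t"
      by (intro antisym SUP_least SUP_upper2[of Z]) (auto simp: R)
    then show ?thesis
      by (simp add: p)
  qed
  ultimately show ?thesis
    by (rule measurable_cong[THEN iffD1, rotated])
qed

text \<open>In the coordinates \<open>x = g ** stack \<omega> t\<close>, which preserve volume,
  \<open>\<xi>'x = t\<close>; the integral over \<omega> is the plane integral.\<close>

lemma nn_integral_plane_integral:
  fixes h :: "real ^ 'm ^ ('k::finite + 'l::finite) \<Rightarrow> ennreal"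
  assumes \<xi>: "\<xi> \<in> stiefel" and [measurable]: "h \<in> borel_measurable borel"
  shows "(\<integral>\<^sup>+t. ennreal (exp (- (norm t)\<^sup>2)) * plane_integral h \<xi> t \<partial>lborel)
    = (\<integral>\<^sup>+x. ennreal (exp (- (norm (transpose \<xi> ** x))\<^sup>2)) * h x \<partial>lborel)"
proof -
  define g where "g = frame_rotation \<xi>"
  have g: "orthogonal_matrix g" and \<xi>: "\<xi> = g ** stiefel_base"
    using frame_rotation[OF \<xi>] by (simp_all add: g_def)
  have gg: "transpose g ** g = mat 1"
    using g by (simp add: orthogonal_matrix)
  have "\<bar>det g\<bar> = 1"
    using det_orthogonal_matrix[OF g] by auto
  have t: "transpose \<xi> ** (g ** stack \<omega> t) = t" for \<omega> :: "real ^ 'm ^ 'k" and t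
  proof -
    have "transpose \<xi> ** (g ** stack \<omega> t) = transpose stiefel_base ** ((transpose g ** g) ** stack \<omega> t)"
      by (simp add: \<xi> matrix_transpose_mul matrix_mul_assoc)
    then show ?thesis
      by (simp add: gg coordinate_projections)
  qed
  have "(\<integral>\<^sup>+x. ennreal (exp (- (norm (transpose \<xi> ** x))\<^sup>2)) * h x \<partial>lborel)
      = (\<integral>\<^sup>+x. ennreal (exp (- (norm (transpose \<xi> ** (g ** x)))\<^sup>2)) * h (g ** x) \<partial>lborel)"
    using \<open>\<bar>det g\<bar> = 1\<close> by (subst nn_integral_lborel_matrix_mult[of g]) auto
  also have "\<dots> = (\<integral>\<^sup>+t. \<integral>\<^sup>+\<omega>. ennreal (exp (- (norm t)\<^sup>2)) * h (g ** stack \<omega> t) \<partial>(lborel :: (real ^ 'm ^ 'k) measure) \<partial>lborel)"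
    by (subst nn_integral_lborel_stack) (simp_all add: t)
  also have "\<dots> = (\<integral>\<^sup>+t. ennreal (exp (- (norm t)\<^sup>2)) * plane_integral h \<xi> t \<partial>lborel)"
    by (intro nn_integral_cong) (simp add: plane_integral_def g_def nn_integral_cmult)
  finally show ?thesis ..
qed

text \<open>The Gaussian weight in t makes the total integral over frames and offsets finite:
  Tonelli rewrites it as the integral of \<open>h\<close> against
  \<open>frame_average \<sigma>\<close>.\<close>

lemma AE_plane_integral_finite:
  fixes h :: "real ^ 'm ^ ('k::finite + 'l::finite) \<Rightarrow> ennreal" and \<sigma> :: "(real ^ 'l ^ ('k + 'l)) measure"
  assumes \<sigma>: "stiefel_invariant_measure \<sigma>" and h[measurable]: "h \<in> borel_measurable borel"
    and fin: "(\<integral>\<^sup>+x. ennreal (gram_det x powr (- real CARD('l) / 2)) * h x \<partial>lborel) < \<infinity>"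
  shows "AE (\<xi>, t) in \<sigma> \<Otimes>\<^sub>M lborel. \<xi> \<in> stiefel \<and> plane_integral h \<xi> t < \<infinity>"
proof -
  interpret finite_measure \<sigma>
    using \<sigma> by (simp add: stiefel_invariant_measure_def)
  interpret xx: pair_sigma_finite \<sigma> "lborel :: (real ^ 'm ^ ('k + 'l)) measure" ..
  obtain C where C: "C < \<infinity>" "\<And>x :: real ^ 'm ^ ('k + 'l).
      frame_average \<sigma> x \<le> C * ennreal (gram_det x powr (- real CARD('l) / 2))"
    using frame_average_le_gram_det[OF \<sigma>, where 'm = 'm] by blast
  note H = borel_measurable_plane_integral[OF \<sigma> h]
  have [measurable]: "fst \<in> borel_measurable (\<sigma> \<Otimes>\<^sub>M (lborel :: (real ^ 'm ^ ('k + 'l)) measure))"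
    by (rule measurable_compose[OF measurable_fst borel_measurable_stiefel_invariant_measure[OF \<sigma>]]) simp
  define F where "F = (\<lambda>(\<xi>, t). ennreal (exp (- (norm t)\<^sup>2)) * plane_integral h \<xi> t)"
  have F: "F \<in> borel_measurable (\<sigma> \<Otimes>\<^sub>M (lborel :: (real ^ 'm ^ 'l) measure))"
    using H unfolding F_def split_beta' by measurable
  have "(\<integral>\<^sup>+p. F p \<partial>(\<sigma> \<Otimes>\<^sub>M lborel)) = (\<integral>\<^sup>+\<xi>. \<integral>\<^sup>+t. F (\<xi>, t) \<partial>lborel \<partial>\<sigma>)"
    by (rule lborel.nn_integral_fst[symmetric]) (rule F)
  also have "\<dots> = (\<integral>\<^sup>+\<xi>. \<integral>\<^sup>+x. ennreal (exp (- (norm (transpose \<xi> ** x))\<^sup>2)) * h x \<partial>lborel \<partial>\<sigma>)"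
    using nn_integral_plane_integral[OF _ h]
    by (intro nn_integral_cong) (simp add: F_def space_stiefel_invariant_measure[OF \<sigma>])
  also have "\<dots> = (\<integral>\<^sup>+x. \<integral>\<^sup>+\<xi>. ennreal (exp (- (norm (transpose \<xi> ** x))\<^sup>2)) * h x \<partial>\<sigma> \<partial>lborel)"
    by (rule xx.Fubini'[symmetric]) measurable
  also have "\<dots> = (\<integral>\<^sup>+x. frame_average \<sigma> x * h x \<partial>lborel)"
    unfolding frame_average_def
    by (intro nn_integral_cong nn_integral_multc borel_measurable_stiefel_invariant_measure[OF \<sigma>]) simp
  also have "\<dots> \<le> (\<integral>\<^sup>+x. C * (ennreal (gram_det x powr (- real CARD('l) / 2)) * h x) \<partial>lborel)"
    using C(2) by (intro nn_integral_mono) (simp add: mult.assoc[symmetric] mult_right_mono)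
  also have "\<dots> = C * (\<integral>\<^sup>+x. ennreal (gram_det x powr (- real CARD('l) / 2)) * h x \<partial>lborel)"
    by (rule nn_integral_cmult) simp
  also have "\<dots> < \<infinity>"
    using C(1) fin unfolding infinity_ennreal_def ennreal_mult_less_top by blast
  finally have "AE p in \<sigma> \<Otimes>\<^sub>M lborel. F p \<noteq> \<infinity>"
    by (intro nn_integral_PInf_AE F) simp
  \<comment> \<open>The weight is strictly positive, so finiteness of \<open>F\<close> passes to the
    plane integral.\<close>
  then have "AE p in \<sigma> \<Otimes>\<^sub>M lborel. case p of (\<xi>, t) \<Rightarrow> \<xi> \<in> stiefel \<and> plane_integral h \<xi> t < \<infinity>"
  proof (rule AE_mp, intro AE_I2 impI)
    fix p assume "p \<in> space (\<sigma> \<Otimes>\<^sub>M (lborel :: (real ^ 'm ^ 'l) measure))" "F p \<noteq> \<infinity>"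
    then show "case p of (\<xi>, t) \<Rightarrow> \<xi> \<in> stiefel \<and> plane_integral h \<xi> t < \<infinity>"
      by (auto simp: F_def space_pair_measure space_stiefel_invariant_measure[OF \<sigma>]
          ennreal_mult_less_top simp flip: less_top)
  qed
  then show ?thesis
    by simp
qed

subsection \<open>Finiteness of the Radon transform\<close>

text \<open>The preimages differ by a subset of a null set, and Lebesgue measure is
  complete.\<close>

lemma borel_measurable_lebesgue_cong_AE:
  fixes f g :: "'a::euclidean_space \<Rightarrow> 'b::topological_space"
  assumes g: "g \<in> borel_measurable lebesgue" and eq: "AE x in lebesgue. f x = g x"
  shows "f \<in> borel_measurable lebesgue"
proof (rule measurableI)
  fix A :: "'b set" assume "A \<in> sets borel"
  then have meas: "g -` A \<inter> space lebesgue \<in> sets lebesgue"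
    by (rule measurable_sets[OF g])
  have ae: "AE x in lebesgue. x \<in> g -` A \<inter> space lebesgue \<longleftrightarrow> x \<in> f -` A \<inter> space lebesgue"
    using eq by eventually_elim simp
  show "f -` A \<inter> space lebesgue \<in> sets lebesgue"
    by (rule completion.in_sets_AE[OF ae meas]) (rule Int_lower2)
qed simp

lemma borel_measurable_gram_det_lebesgue:
  "(\<lambda>x. complex_of_real (gram_det x powr c)) \<in> borel_measurable lebesgue"
  by (rule measurable_completion) measurable

lemma integrable_lebesgue_gram_det:
  fixes a :: real
  assumes "a > real CARD('r) + real CARD('m) - 1"
  shows "integrable lebesgue (\<lambda>x :: real ^ 'm ^ 'r. gram_det x powr (- a / 2))"
proof -
  have "integrable lborel (\<lambda>x :: real ^ 'm ^ 'r. gram_det x powr (- a / 2))"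
    using nn_integral_gram_det[OF assms] by (intro integrableI_nonneg) auto
  then show ?thesis
    by (simp add: integrable_completion)
qed

lemma one_le_real_card: "1 \<le> real CARD('a::finite)"
proof -
  have "real 1 \<le> real CARD('a)"
    unfolding of_nat_le_iff by (rule Suc_leI[OF zero_less_card_finite, folded One_nat_def])
  then show ?thesis
    by simp
qed

lemma continuous_on_gram_det: "continuous_on S (gram_det :: real ^ 'm ^ 'n \<Rightarrow> real)"
  unfolding gram_det_def det_def matrix_matrix_mult_def transpose_def by (intro continuous_intros)

text \<open>The asymptotic bound holds outside some ball; inside, the quotient of
  \<open>norm (f x)\<close> by the weight is continuous on a compact set. The larger of the two
  constants serves everywhere.\<close>

lemma bigo_gram_det_bound:
  fixes f :: "real ^ 'm ^ 'n \<Rightarrow> complex"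
  assumes cont: "continuous_on UNIV f"
    and bigo: "(\<lambda>x. norm (f x)) \<in> O[at_infinity](\<lambda>x. gram_det x powr (- a / 2))"
  obtains C where "\<And>x. norm (f x) \<le> C * gram_det x powr (- a / 2)"
proof -
  obtain c where "eventually (\<lambda>x. norm (norm (f x)) \<le> c * norm (gram_det x powr (- a / 2))) at_infinity"
    using bigo by (rule landau_o.bigE)
  then obtain r where r: "\<And>x. r \<le> norm x \<Longrightarrow> norm (f x) \<le> c * gram_det x powr (- a / 2)"
    by (auto simp: eventually_at_infinity)
  have pos: "gram_det x > 0" for x :: "real ^ 'm ^ 'n"
    using gram_det_ge_1[of x] by simp
  have "continuous_on (cball 0 r) (\<lambda>x. norm (f x) * gram_det x powr (a / 2))"
    using pos by (intro continuous_intros continuous_on_subset[OF cont] continuous_on_gram_det) (auto simp: less_imp_neq[symmetric])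
  then have "bounded ((\<lambda>x. norm (f x) * gram_det x powr (a / 2)) ` cball 0 r)"
    by (intro compact_imp_bounded compact_continuous_image) auto
  then obtain M where M: "\<And>x. norm x \<le> r \<Longrightarrow> norm (f x) * gram_det x powr (a / 2) \<le> M"
    by (force simp: bounded_iff)
  show thesis
  proof
    fix x :: "real ^ 'm ^ 'n"
    have inv: "gram_det x powr (a / 2) * gram_det x powr (- a / 2) = 1"
      using pos[of x] by (simp flip: powr_add)
    show "norm (f x) \<le> max c M * gram_det x powr (- a / 2)"
    proof (cases "norm x \<le> r")
      case True
      have "norm (f x) = (norm (f x) * gram_det x powr (a / 2)) * gram_det x powr (- a / 2)"
        using inv by (simp add: mult.assoc)
      also have "\<dots> \<le> max c M * gram_det x powr (- a / 2)"
        using M[OF True] by (intro mult_right_mono) auto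
      finally show ?thesis .
    next
      case False
      then have "norm (f x) \<le> c * gram_det x powr (- a / 2)"
        by (intro r) simp
      also have "\<dots> \<le> max c M * gram_det x powr (- a / 2)"
        by (intro mult_right_mono) auto
      finally show ?thesis .
    qed
  qed
qed

text \<open>The rotation leaves \<open>gram_det\<close> unchanged, and discarding the rows t can
  only decrease it. So a multiple of \<open>gram_det \<omega> powr (- a / 2)\<close>, integrable by
  the first estimate, dominates on every plane.\<close>

lemma radon_finite_if_bigo:
  fixes f :: "real ^ 'm ^ ('k::finite + 'l::finite) \<Rightarrow> complex"
  assumes cont: "continuous_on UNIV f"
    and bigo: "(\<lambda>x. norm (f x)) \<in> O[at_infinity](\<lambda>x. gram_det x powr (- a / 2))"
    and a: "a > real CARD('k) + real CARD('m) - 1" and \<xi>: "\<xi> \<in> stiefel"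
  shows "radon_finite f \<xi> t"
proof -
  obtain C where C: "\<And>x. norm (f x) \<le> C * gram_det x powr (- a / 2)"
    using bigo_gram_det_bound[OF cont bigo] by blast
  have [measurable]: "f \<in> borel_measurable borel"
    using cont by (rule borel_measurable_continuous_onI)
  have "0 \<le> C * gram_det (0 :: real ^ 'm ^ ('k + 'l)) powr (- a / 2)"
    using C[of 0] norm_ge_zero[of "f 0"] by linarith
  then have "0 \<le> C"
    using gram_det_ge_1[of "0 :: real ^ 'm ^ ('k + 'l)"] by (simp add: zero_le_mult_iff)
  have "1 \<le> real CARD('k)" "1 \<le> real CARD('m)"
    by (rule one_le_real_card)+
  then have "0 \<le> a"
    using a by linarith
  have "norm (radon_integrand f \<xi> t \<omega>) \<le> norm (C * gram_det \<omega> powr (- a / 2))" for \<omega>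
  proof -
    have "norm (radon_integrand f \<xi> t \<omega>) \<le> C * gram_det (stack \<omega> t) powr (- a / 2)"
      using C[of "frame_rotation \<xi> ** stack \<omega> t"] frame_rotation(1)[OF \<xi>]
      by (simp add: radon_integrand_def gram_det_orthogonal)
    also have "\<dots> \<le> C * gram_det \<omega> powr (- a / 2)"
      using gram_det_stack_ge[of \<omega> t] gram_det_ge_1[of \<omega>] \<open>0 \<le> C\<close> \<open>0 \<le> a\<close>
      by (intro mult_left_mono powr_mono2') auto
    finally show ?thesis
      using \<open>0 \<le> C\<close> by simp
  qed
  then have bound: "AE \<omega> in lebesgue. norm (radon_integrand f \<xi> t \<omega>) \<le> norm (C * gram_det \<omega> powr (- a / 2))"
    by (intro AE_I2)
  have "(\<lambda>\<omega>. f (frame_rotation \<xi> ** stack \<omega> t)) \<in> borel_measurable lborel"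
    by measurable
  then have meas: "radon_integrand f \<xi> t \<in> borel_measurable lebesgue"
    unfolding radon_integrand_def[abs_def] by (rule measurable_completion)
  show ?thesis
    unfolding radon_finite_def
    by (rule Bochner_Integration.integrable_bound[OF integrable_mult_right[OF integrable_lebesgue_gram_det[OF a]] meas bound])
qed

text \<open>The weight never vanishes, so it can be divided out.\<close>

lemma in_weighted_L1_measurable:
  fixes f :: "real ^ 'm ^ 'n \<Rightarrow> complex"
  assumes "in_weighted_L1 \<alpha> f"
  shows "f \<in> borel_measurable lebesgue"
proof -
  have "(\<lambda>x. complex_of_real (gram_det x powr (\<alpha> / 2)) * f x) \<in> borel_measurable lebesgue"
    using assms by (auto simp: in_weighted_L1_def)
  then have "(\<lambda>x. complex_of_real (gram_det x powr (- \<alpha> / 2)) * (complex_of_real (gram_det x powr (\<alpha> / 2)) * f x))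
      \<in> borel_measurable lebesgue"
    by (rule borel_measurable_times[OF borel_measurable_gram_det_lebesgue])
  moreover have "complex_of_real (gram_det x powr (- \<alpha> / 2)) * (complex_of_real (gram_det x powr (\<alpha> / 2)) * f x) = f x" for x
  proof -
    have "gram_det x powr (- \<alpha> / 2) * gram_det x powr (\<alpha> / 2) = 1"
      using gram_det_ge_1[of x] by (simp flip: powr_add)
    then show ?thesis
      by (simp only: mult.assoc[symmetric] of_real_mult[symmetric] of_real_1 mult_1)
  qed
  ultimately show ?thesis
    by (simp only:)
qed

text \<open>Restriction to a plane, itself a null set, need not preserve Lebesgue measurability. A
  Borel version off a Borel null set keeps the restrictions under control.\<close>

lemma lebesgue_measurable_eq_borel_off_null_set:
  fixes f :: "'a::euclidean_space \<Rightarrow> complex"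
  assumes "f \<in> borel_measurable lebesgue"
  obtains f0 :: "'a \<Rightarrow> complex" and N where "f0 \<in> borel_measurable borel" "N \<in> null_sets lborel" "\<And>x. x \<notin> N \<Longrightarrow> f x = f0 x"
proof -
  have "(\<lambda>x. Re (f x)) \<in> borel_measurable lebesgue" "(\<lambda>x. Im (f x)) \<in> borel_measurable lebesgue"
    using assms by measurable
  then obtain u v where "u \<in> borel_measurable lborel" "v \<in> borel_measurable lborel"
    and eq: "AE x in lborel. Re (f x) = u x" "AE x in lborel. Im (f x) = v x"
    using completion_ex_borel_measurable_real[of "\<lambda>x. Re (f x)"]
      completion_ex_borel_measurable_real[of "\<lambda>x. Im (f x)"] by blast
  then have [measurable]: "u \<in> borel_measurable borel" "v \<in> borel_measurable borel"
    by simp_all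
  from eq have "AE x in lborel. f x = Complex (u x) (v x)"
    by eventually_elim (simp add: complex_eq_iff)
  then obtain N where N: "{x \<in> space lborel. f x \<noteq> Complex (u x) (v x)} \<subseteq> N" "N \<in> null_sets lborel"
    unfolding eventually_ae_filter by blast
  have "(\<lambda>x. complex_of_real (u x) + \<i> * complex_of_real (v x)) \<in> borel_measurable borel"
    by measurable
  then have "(\<lambda>x. Complex (u x) (v x)) \<in> borel_measurable borel"
    by (simp only: Complex_eq)
  then show thesis
    by (rule that[OF _ N(2)]) (use N(1) in auto)
qed

lemma AE_radon_finite:
  fixes f :: "real ^ 'm ^ ('k::finite + 'l::finite) \<Rightarrow> complex" and \<sigma> :: "(real ^ 'l ^ ('k + 'l)) measure"
  assumes \<sigma>: "stiefel_invariant_measure \<sigma>" and f: "in_weighted_L1 \<alpha> f" and \<alpha>: "\<alpha> \<ge> - real CARD('l)"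
  shows "AE (\<xi>, t) in \<sigma> \<Otimes>\<^sub>M lborel. radon_finite f \<xi> t"
proof -
  obtain f0 :: "real ^ 'm ^ ('k + 'l) \<Rightarrow> complex" and N
    where f0[measurable]: "f0 \<in> borel_measurable borel" and N: "N \<in> null_sets lborel"
      and eq: "\<And>x. x \<notin> N \<Longrightarrow> f x = f0 x"
    using lebesgue_measurable_eq_borel_off_null_set[OF in_weighted_L1_measurable[OF f]] by blast
  have [measurable]: "N \<in> sets borel"
    using N by auto
  \<comment> \<open>The value \<open>\<infinity>\<close> on \<open>N\<close> ensures that a plane with finite integral of \<open>h\<close> meets \<open>N\<close> in a null set, so that
    \<open>f\<close> is measurable on it.\<close>
  define h where "h x = (if x \<in> N then \<infinity> else ennreal (norm (f0 x)))" for x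
  have h[measurable]: "h \<in> borel_measurable borel"
    unfolding h_def by measurable
  have "(\<integral>\<^sup>+x. ennreal (gram_det x powr (- real CARD('l) / 2)) * h x \<partial>lborel)
      \<le> (\<integral>\<^sup>+x. ennreal (norm (complex_of_real (gram_det x powr (\<alpha> / 2)) * f x)) \<partial>lborel)"
  proof (rule nn_integral_mono_AE)
    show "AE x in lborel. ennreal (gram_det x powr (- real CARD('l) / 2)) * h x
        \<le> ennreal (norm (complex_of_real (gram_det x powr (\<alpha> / 2)) * f x))"
      using AE_not_in[OF N]
    proof eventually_elim
      case (elim x)
      have "gram_det x powr (- real CARD('l) / 2) * norm (f x) \<le> gram_det x powr (\<alpha> / 2) * norm (f x)"
        using gram_det_ge_1[of x] \<alpha> by (intro mult_right_mono powr_mono) auto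
      moreover have "h x = ennreal (norm (f x))"
        using elim eq[OF elim] by (simp add: h_def)
      ultimately show ?case
        by (simp add: norm_mult ennreal_leI flip: ennreal_mult)
    qed
  qed
  also have "\<dots> = (\<integral>\<^sup>+x. ennreal (norm (complex_of_real (gram_det x powr (\<alpha> / 2)) * f x)) \<partial>lebesgue)"
    by (rule nn_integral_completion[symmetric])
  also have "\<dots> < \<infinity>"
    using f by (simp add: in_weighted_L1_def integrable_iff_bounded)
  finally have fin: "AE (\<xi>, t) in \<sigma> \<Otimes>\<^sub>M lborel. \<xi> \<in> stiefel \<and> plane_integral h \<xi> t < \<infinity>"
    by (rule AE_plane_integral_finite[OF \<sigma> h])
  \<comment> \<open>No exceptional set enters here: on every plane with finite integral of
    \<open>h\<close>, the integrand agrees almost everywhere with an integrable Borel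
    function.\<close>
  have finite_imp: "radon_finite f \<xi> t" if \<xi>: "\<xi> \<in> stiefel" and fin: "plane_integral h \<xi> t < \<infinity>"
    for \<xi> :: "real ^ 'l ^ ('k + 'l)" and t :: "real ^ 'm ^ 'l"
  proof -
    let ?p = "\<lambda>\<omega> :: real ^ 'm ^ 'k. frame_rotation \<xi> ** stack \<omega> t"
    have "AE \<omega> in lborel. h (?p \<omega>) \<noteq> \<infinity>"
      using fin unfolding plane_integral_def by (intro nn_integral_PInf_AE) simp_all
    then have ae: "AE \<omega> in lborel. ?p \<omega> \<notin> N"
      by eventually_elim (auto simp: h_def)
    have "(\<integral>\<^sup>+\<omega>. ennreal (norm (f0 (?p \<omega>))) \<partial>lborel) \<le> plane_integral h \<xi> t"
      unfolding plane_integral_def by (rule nn_integral_mono) (simp add: h_def)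
    then have "integrable lborel (\<lambda>\<omega>. f0 (?p \<omega>))"
      using fin by (intro integrableI_bounded) (auto intro: le_less_trans)
    then have int: "integrable lebesgue (\<lambda>\<omega>. f0 (?p \<omega>))"
      by (simp add: integrable_completion)
    have ae': "AE \<omega> in lebesgue. radon_integrand f \<xi> t \<omega> = f0 (?p \<omega>)"
      using AE_completion[OF ae] by eventually_elim (simp add: radon_integrand_def eq)
    then have meas: "radon_integrand f \<xi> t \<in> borel_measurable lebesgue"
      by (rule borel_measurable_lebesgue_cong_AE[OF borel_measurable_integrable[OF int]])
    have "AE \<omega> in lebesgue. f0 (?p \<omega>) = radon_integrand f \<xi> t \<omega>"
      using ae' by eventually_elim simp
    then show ?thesis
      unfolding radon_finite_def by (rule integrable_cong_AE_imp[OF int meas])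
  qed
  show ?thesis
    using fin by (rule eventually_mono) (auto intro: finite_imp)
qed

text \<open>Young's inequality with the factors \<open>1 / p\<close> and \<open>1 / q\<close>, both
  below 1, dropped.\<close>

lemma mult_le_sum_powr:
  fixes a b p q :: real
  assumes "p > 1" "1 / p + 1 / q = 1" "0 \<le> a" "0 \<le> b"
  shows "a * b \<le> a powr p + b powr q"
proof -
  have "1 / q = 1 - 1 / p" "1 / p < 1" "0 < 1 / p"
    using assms by simp_all
  then have "0 < 1 / q" "1 / q < 1"
    by linarith+
  then have "q > 1"
    by (simp add: divide_less_eq_1 split: if_splits)
  then have "a * b \<le> a powr p / p + b powr q / q"
    using assms by (intro Youngs_inequality) auto
  also have "\<dots> \<le> a powr p + b powr q"
    using assms \<open>q > 1\<close> by (intro add_mono) (auto simp: divide_le_eq mult_left_le mult_le_cancel_left1)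
  finally show ?thesis .
qed

text \<open>Young's inequality splits the weighted function into \<open>norm (f x) powr p\<close>
  and the weight to the conjugate power \<open>q\<close>. The latter is integrable by the first
  estimate when \<open>l * q > n + m - 1\<close>, which is the condition on \<open>p\<close>
  rewritten.\<close>

lemma in_Lp_imp_in_weighted_L1:
  fixes f :: "real ^ 'm ^ ('k::finite + 'l::finite) \<Rightarrow> complex"
  assumes p: "1 \<le> p" "p < (real CARD('k + 'l) + real CARD('m) - 1) / (real CARD('k) + real CARD('m) - 1)"
    and f: "in_Lp p f"
  shows "in_weighted_L1 (- real CARD('l)) f"
proof -
  let ?w = "\<lambda>x :: real ^ 'm ^ ('k + 'l). gram_det x powr (- real CARD('l) / 2)"
  have fm: "f \<in> borel_measurable lebesgue" and fp: "integrable lebesgue (\<lambda>x. norm (f x) powr p)"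
    using f by (auto simp: in_Lp_def)
  have meas: "(\<lambda>x. complex_of_real (?w x) * f x) \<in> borel_measurable lebesgue"
    by (intro borel_measurable_times borel_measurable_gram_det_lebesgue fm)
  have "\<exists>g. integrable lebesgue g \<and> (\<forall>x. ?w x * norm (f x) \<le> g x)"
  proof (cases "p = 1")
    \<comment> \<open>Here the conjugate exponent would be infinite; the bound 1 on the weight takes
      its place.\<close>
    case True
    have "?w x * norm (f x) \<le> norm (f x) powr p" for x
    proof -
      have "?w x \<le> 1"
        using powr_mono2'[of "- real CARD('l) / 2" 1 "gram_det x"] gram_det_ge_1[of x] by simp
      then show ?thesis
        using True mult_left_le_one_le[OF norm_ge_zero powr_ge_zero, of "gram_det x" "- real CARD('l) / 2" "f x"]
        by simp
    qed
    then show ?thesis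
      using fp by blast
  next
    case False
    then have "p > 1"
      using p by simp
    define q where "q = p / (p - 1)"
    have q: "1 / p + 1 / q = 1"
      using \<open>p > 1\<close> by (simp add: q_def field_simps)
    have "1 \<le> real CARD('k)" "1 \<le> real CARD('m)"
      by (rule one_le_real_card)+
    then have "0 < real CARD('k) + real CARD('m) - 1"
      by linarith
    then have "p * (real CARD('k) + real CARD('m) - 1) < real CARD('k + 'l) + real CARD('m) - 1"
      using p(2) by (simp add: less_divide_eq)
    then have "(real CARD('k + 'l) + real CARD('m) - 1) * (p - 1) < real CARD('l) * p"
      by (simp add: algebra_simps)
    then have "real CARD('l) * q > real CARD('k + 'l) + real CARD('m) - 1"
      using \<open>p > 1\<close> by (simp add: q_def less_divide_eq)
    from integrable_lebesgue_gram_det[OF this]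
    have "integrable lebesgue (\<lambda>x :: real ^ 'm ^ ('k + 'l). ?w x powr q)"
      by (simp add: powr_powr)
    then have "integrable lebesgue (\<lambda>x. norm (f x) powr p + ?w x powr q)"
      by (intro Bochner_Integration.integrable_add fp)
    moreover have "?w x * norm (f x) \<le> norm (f x) powr p + ?w x powr q" for x
      using mult_le_sum_powr[OF \<open>p > 1\<close> q, of "norm (f x)" "?w x"] by (simp add: mult.commute)
    ultimately show ?thesis
      by blast
  qed
  then obtain g where g: "integrable lebesgue g" "\<And>x. ?w x * norm (f x) \<le> g x"
    by blast
  have "norm (complex_of_real (?w x) * f x) \<le> norm (g x)" for x
  proof -
    have "norm (complex_of_real (?w x) * f x) = ?w x * norm (f x)"
      by (simp add: norm_mult)
    also have "\<dots> \<le> norm (g x)"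
      using g(2)[of x] by simp
    finally show ?thesis .
  qed
  then show ?thesis
    unfolding in_weighted_L1_def by (intro Bochner_Integration.integrable_bound[OF g(1) meas] AE_I2)
qed

theorem theorem0p5:
  fixes f :: "real ^ 'm ^ ('k::finite + 'l::finite) \<Rightarrow> complex"
    and \<sigma> :: "(real ^ 'l ^ ('k + 'l)) measure"
    and n m k :: nat
  assumes n: "n = CARD('k + 'l)" and m: "m = CARD('m)" and k: "k = CARD('k)"
    and "m \<le> n"
    and \<sigma>: "stiefel_invariant_measure \<sigma>"
  shows
    "(\<forall>a::real.
        continuous_on UNIV f \<longrightarrow>
        (\<lambda>x. norm (f x)) \<in> O[at_infinity](\<lambda>x. gram_det x powr (- a / 2)) \<longrightarrow>
        a > real k + real m - 1 \<longrightarrow>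
        (\<forall>\<xi>\<in>stiefel. \<forall>t. radon_finite f \<xi> t)) \<and>
     ((\<exists>\<alpha>\<ge>real k - real n. in_weighted_L1 \<alpha> f) \<longrightarrow>
        (AE (\<xi>, t) in \<sigma> \<Otimes>\<^sub>M lborel. radon_finite f \<xi> t)) \<and>
     (\<forall>p::real.
        1 \<le> p \<longrightarrow> p < (real n + real m - 1) / (real k + real m - 1) \<longrightarrow> in_Lp p f \<longrightarrow>
        (\<exists>\<alpha>\<ge>real k - real n. in_weighted_L1 \<alpha> f) \<and>
        (AE (\<xi>, t) in \<sigma> \<Otimes>\<^sub>M lborel. radon_finite f \<xi> t))"
proof -
  have l: "real k - real n = - real CARD('l)"
    by (simp add: n k)
  have weighted: "AE (\<xi>, t) in \<sigma> \<Otimes>\<^sub>M lborel. radon_finite f \<xi> t"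
    if "in_weighted_L1 \<alpha> f" "\<alpha> \<ge> real k - real n" for \<alpha>
    using AE_radon_finite[OF \<sigma> that(1)] that(2) by (simp add: l)
  \<comment> \<open>The endpoint exponent \<open>k - n = - l\<close> is the witness for every
    admissible \<open>p\<close>.\<close>
  have "in_weighted_L1 (real k - real n) f"
    if "1 \<le> p" "p < (real n + real m - 1) / (real k + real m - 1)" "in_Lp p f" for p
    using in_Lp_imp_in_weighted_L1[of p f] that by (simp add: l) (simp add: n m k)
  then have Lp: "\<exists>\<alpha>\<ge>real k - real n. in_weighted_L1 \<alpha> f"
    if "1 \<le> p" "p < (real n + real m - 1) / (real k + real m - 1)" "in_Lp p f" for p
    using that by blast
  show ?thesis
  proof (intro conjI allI impI ballI)
    fix a :: real and \<xi> :: "real ^ 'l ^ ('k + 'l)" and t :: "real ^ 'm ^ 'l"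
    assume "continuous_on UNIV f" "(\<lambda>x. norm (f x)) \<in> O[at_infinity](\<lambda>x. gram_det x powr (- a / 2))"
      "a > real k + real m - 1" "\<xi> \<in> stiefel"
    then show "radon_finite f \<xi> t"
      unfolding m k by (rule radon_finite_if_bigo)
  next
    assume "\<exists>\<alpha>\<ge>real k - real n. in_weighted_L1 \<alpha> f"
    then show "AE (\<xi>, t) in \<sigma> \<Otimes>\<^sub>M lborel. radon_finite f \<xi> t"
      using weighted by blast
  next
    fix p :: real
    assume "1 \<le> p" "p < (real n + real m - 1) / (real k + real m - 1)" "in_Lp p f"
    from Lp[OF this] show "\<exists>\<alpha>\<ge>real k - real n. in_weighted_L1 \<alpha> f"
      "AE (\<xi>, t) in \<sigma> \<Otimes>\<^sub>M lborel. radon_finite f \<xi> t"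
      using weighted by blast+
  qed
qed

end
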